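(* Let $n\ge 2$ be an integer, $0<s\le\frac n4$ with $s\notin\mathbb{Z}$, and let $f\in L^{\frac{2n}{n+4s}}(\mathbb{R}^n)$. If there exists a nonempty open set $U$ in $\mathbb{R}^n$ such that $f=\mathcal{A}_sf=0$ in $U$, then $f=0$ in $\mathbb{R}^n$.
   Context: For $0<s<\frac n2$ the fractional momentum ray transform is $(\mathcal{X}_sf)(x,\xi)=\int_0^\infty\tau^{2s-1}f(x+\tau\xi)\,d\tau$, $(x,\xi)\in\mathbb{R}^n\times\mathbb{S}^{n-1}$, and its spherical average is $$(\mathcal{A}_sf)(x)=c(n,-s)\int_{\mathbb{S}^{n-1}}(\mathcal{X}_sf)(x,\xi)\,dS_\xi=c(n,-s)\int_{\mathbb{R}^n}|y|^{2s-n}f(x+y)\,dy,$$ where $c(n,s):=\frac{2^{2s}\Gamma(\frac{n+2s}{2})}{\pi^{n/2}|\Gamma(-s)|}$. These are first defined for Schwartz $f$; $\mathcal{A}_s$ (the Riesz potential) is extended to $L^p(\mathbb{R}^n)$, $1\le p<\frac{n}{2s}$, by the last integral. *)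

theory Defs
  imports "HOL-Analysis.Analysis"
begin

definition frac_const :: "nat \<Rightarrow> real \<Rightarrow> real" where
  "frac_const n s =
     2 powr (2 * s) * Gamma ((real n + 2 * s) / 2) / (pi powr (real n / 2) * \<bar>Gamma (- s)\<bar>)"

text \<open>
  The spherical average of the fractional momentum ray transform, that is the Riesz potential of
  order \<open>2 s\<close>, in the form in which it is extended from Schwartz functions to \<open>L\<^sup>p\<close>. For
  \<open>f\<close> in \<open>L\<^sup>p\<close> with \<open>1 \<le> p < n / (2 s)\<close> the integral converges absolutely for almost every \<open>x\<close>;
  the Bochner integral takes the default value \<open>0\<close> on the remaining null set. The convention
  \<open>0 powr a = 0\<close> changes the kernel only at \<open>y = 0\<close>.
\<close>
definition ray_avg :: "real \<Rightarrow> (real^'n \<Rightarrow> complex) \<Rightarrow> real^'n \<Rightarrow> complex" where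
  "ray_avg s f x =
     frac_const CARD('n) (- s) *\<^sub>R
       (\<integral>y. norm y powr (2 * s - real CARD('n)) *\<^sub>R f (x + y) \<partial>lebesgue)"

text \<open>
  Membership of a representative in \<open>L\<^sup>p\<close> for finite \<open>p > 0\<close>; elements of \<open>L\<^sup>p\<close> are functions up to
  equality almost everywhere.
\<close>
definition in_Lp :: "real \<Rightarrow> (real^'n \<Rightarrow> complex) \<Rightarrow> bool" where
  "in_Lp p f \<longleftrightarrow>
     f \<in> borel_measurable lebesgue \<and> integrable lebesgue (\<lambda>x. norm (f x) powr p)"

end

theory Submission
  imports Defs "HOL-Complex_Analysis.Cauchy_Integral_Formula" "HOL-Real_Asymp.Real_Asymp"
begin

text \<open>
  Up to a non-zero constant the transform is convolution with \<open>\<bar>y\<bar>\<^sup>a\<close>, where \<open>a = 2 s - n < 0\<close>. The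
  integrability assumption on \<open>f\<close> makes this convolution absolutely convergent at every point of
  \<open>U\<close>, where \<open>f\<close> vanishes (\<open>integrable_riesz_kernel\<close>). The core of the argument is
  \<open>riesz_potential_unique_continuation\<close>.

  On \<open>U\<close> the kernel is never evaluated near its singularity, so the potential can be
  differentiated there. As \<open>\<Delta> \<bar>y\<bar>\<^sup>a = a (a + n - 2) \<bar>y\<bar>\<^sup>b\<close> with \<open>b = a - 2\<close>, applying the Laplacian
  repeatedly shows that the potentials with exponents \<open>a, a - 2, a - 4, \<dots>\<close> all vanish on \<open>U\<close>
  (\<open>potential_zero_laplacian\<close>). The factors that arise are non-zero: the exponents are negative, and
  \<open>a - 2 k + n - 2 = 2 (s - k - 1)\<close> with \<open>s\<close> not an integer.
  Seen as functions of \<open>u = 1 / \<bar>y\<bar>\<^sup>2\<close>, the kernels obtained are \<open>\<bar>y\<bar>\<^sup>a\<close> times all the monomials in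
  \<open>u\<close>, and \<open>u\<close> is bounded on the set where \<open>f\<close> lives. By Weierstrass approximation they can be
  combined to any kernel \<open>\<bar>y\<bar>\<^sup>a w(u)\<close> with continuous \<open>w\<close> (\<open>potential_zero_radial\<close>), in
  particular to the Gaussians: all averages of \<open>f\<close> with weight \<open>exp (- c \<bar>z - x\<bar>\<^sup>2)\<close> vanish for
  \<open>x \<in> U\<close> and \<open>c > 0\<close> (\<open>gaussian_average_zero\<close>).

  For fixed \<open>c\<close> these averages are real analytic in \<open>x\<close>, hence they vanish for every \<open>x\<close>
  (\<open>gaussian_averages_zero_extend\<close>). Letting \<open>c\<close> tend to infinity, the Gaussians form an approximate
  identity, and \<open>f\<close> is zero (\<open>gaussian_averages_zero_test\<close>,
  \<open>AE_zero_if_orthogonal_to_continuous\<close>).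
\<close>

section \<open>Second differences of a power of the norm\<close>

lemma ray_power_derivs:
  fixes v e :: "'a::euclidean_space" and a t :: real
  assumes "norm e = 1" and "v + t *\<^sub>R e \<noteq> 0"
  defines "N \<equiv> \<lambda>b t. norm (v + t *\<^sub>R e) powr b"
  shows "((\<lambda>t. N a t) has_real_derivative a * (v \<bullet> e + t) * N (a - 2) t) (at t)"
    and "((\<lambda>t. a * (v \<bullet> e + t) * N (a - 2) t) has_real_derivative
           a * N (a - 2) t + a * (a - 2) * (v \<bullet> e + t)\<^sup>2 * N (a - 4) t) (at t)"
proof -
  have ee: "e \<bullet> e = 1" using assms(1) by (simp add: dot_square_norm)
  have D: "((\<lambda>t. N b t) has_real_derivative b * (v \<bullet> e + t) * N (b - 2) t) (at t)" for b
  proof -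
    have q: "norm (v + t *\<^sub>R e) powr b = ((v + t *\<^sub>R e) \<bullet> (v + t *\<^sub>R e)) powr (b/2)" for t b
    proof (cases "v + t *\<^sub>R e = 0")
      case False
      then show ?thesis by (simp add: dot_square_norm powr_numeral[symmetric] powr_powr del: powr_numeral)
    qed simp
    have pos: "0 < (v + t *\<^sub>R e) \<bullet> (v + t *\<^sub>R e)" using assms(2) by simp
    have I: "((\<lambda>t. (v + t *\<^sub>R e) \<bullet> (v + t *\<^sub>R e)) has_real_derivative 2 * (v \<bullet> e + t)) (at t)"
      unfolding inner_add_left inner_add_right inner_scaleR_left inner_scaleR_right ee
      by (auto intro!: derivative_eq_intros simp: inner_commute)
    have "((\<lambda>t. ((v + t *\<^sub>R e) \<bullet> (v + t *\<^sub>R e)) powr (b/2)) has_real_derivative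
            (b/2) * ((v + t *\<^sub>R e) \<bullet> (v + t *\<^sub>R e)) powr (b/2 - 1) * (2 * (v \<bullet> e + t))) (at t)"
      using DERIV_fun_powr[OF I pos, of "b/2"] by simp
    moreover have "(b/2) * ((v + t *\<^sub>R e) \<bullet> (v + t *\<^sub>R e)) powr (b/2 - 1) * (2 * (v \<bullet> e + t))
        = b * (v \<bullet> e + t) * N (b - 2) t"
      unfolding N_def q[of t "b-2"] by (simp add: diff_divide_distrib)
    moreover have "N b = (\<lambda>t. ((v + t *\<^sub>R e) \<bullet> (v + t *\<^sub>R e)) powr (b/2))"
      unfolding N_def by (intro ext q)
    ultimately show ?thesis by (simp only:)
  qed
  show "((\<lambda>t. N a t) has_real_derivative a * (v \<bullet> e + t) * N (a - 2) t) (at t)" by (rule D)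
  show "((\<lambda>t. a * (v \<bullet> e + t) * N (a - 2) t) has_real_derivative
           a * N (a - 2) t + a * (a - 2) * (v \<bullet> e + t)\<^sup>2 * N (a - 4) t) (at t)"
    by (auto intro!: derivative_eq_intros D simp: power2_eq_square algebra_simps)
qed

text \<open>
  The Taylor expansions to the left and to the right have opposite first-order terms, so their
  sum leaves only the Lagrange remainders: the second difference quotient is the mean of two
  values of the second derivative \<open>P\<close> at points within \<open>h\<close>. Boundedness and convergence of the
  quotient both follow from this.
\<close>

lemma second_difference_taylor:
  fixes v e :: "'a::euclidean_space" and a h :: real
  assumes e: "norm e = 1" and h: "0 < h" "h < norm v"
  defines "P \<equiv> \<lambda>t. a * norm (v + t *\<^sub>R e) powr (a - 2)
                 + a * (a - 2) * (v \<bullet> e + t)\<^sup>2 * norm (v + t *\<^sub>R e) powr (a - 4)"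
  obtains p q where "\<bar>p\<bar> \<le> h" "\<bar>q\<bar> \<le> h"
    "(norm (v + h *\<^sub>R e) powr a + norm (v - h *\<^sub>R e) powr a - 2 * norm v powr a) / h\<^sup>2 = (P p + P q) / 2"
proof -
  define N where "N \<equiv> \<lambda>b t. norm (v + t *\<^sub>R e) powr b"
  define d where "d \<equiv> \<lambda>(m::nat) t. if m = 0 then N a t
      else if m = 1 then a * (v \<bullet> e + t) * N (a - 2) t else P t"
  have nz: "v + t *\<^sub>R e \<noteq> 0" if "-h \<le> t" "t \<le> h" for t
  proof
    assume "v + t *\<^sub>R e = 0"
    then have "norm v = norm (t *\<^sub>R e)" by (simp add: add_eq_0_iff)
    then show False using that h e by auto
  qed
  have der: "\<forall>m t. m < 2 \<and> -h \<le> t \<and> t \<le> h \<longrightarrow> DERIV (d m) t :> d (Suc m) t"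
  proof (intro allI impI, elim conjE)
    fix m :: nat and t assume m: "m < 2" and t: "-h \<le> t" "t \<le> h"
    from m consider "m = 0" | "m = 1" by linarith
    then show "DERIV (d m) t :> d (Suc m) t"
    proof cases
      case 1
      then show ?thesis using ray_power_derivs(1)[OF e nz[OF t], of a] by (simp add: d_def N_def)
    next
      case 2
      then show ?thesis using ray_power_derivs(2)[OF e nz[OF t], of a] by (simp add: d_def N_def P_def)
    qed
  qed
  obtain p where p: "0 < p" "p < h" "N a h = (\<Sum>m<2. d m 0 / fact m * (h - 0)^m) + d 2 p / fact 2 * (h - 0)^2"
    using Taylor[of 2 d "N a" "-h" h 0 h, OF _ _ der] h by (auto simp: d_def)
  obtain q where q: "-h < q" "q < 0" "N a (-h) = (\<Sum>m<2. d m 0 / fact m * (-h - 0)^m) + d 2 q / fact 2 * (-h - 0)^2"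
    using Taylor[of 2 d "N a" "-h" h 0 "-h", OF _ _ der] h by (auto simp: d_def)
  have "N a h + N a (-h) = 2 * N a 0 + (P p + P q) / 2 * h\<^sup>2"
    using p(3) q(3) by (simp add: d_def numeral_2_eq_2 field_simps)
  then have "(norm (v + h *\<^sub>R e) powr a + norm (v - h *\<^sub>R e) powr a - 2 * norm v powr a) / h\<^sup>2 = (P p + P q) / 2"
    using h by (simp add: N_def field_simps)
  then show thesis using p q by (intro that[of p q]) auto
qed

text \<open>
  The discrete Laplacian of \<open>\<bar>v\<bar>\<^sup>a\<close> with step \<open>h\<close>. Integrated against a function it is a combination
  of finitely many values of the potential, hence zero if the potential vanishes
  at those points; no differentiation under the integral sign is involved.
\<close>

definition second_difference_kernel :: "real \<Rightarrow> real \<Rightarrow> 'a::euclidean_space \<Rightarrow> real" where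
  "second_difference_kernel a h v =
     (\<Sum>e\<in>Basis. (norm (v + h *\<^sub>R e) powr a + norm (v - h *\<^sub>R e) powr a - 2 * norm v powr a) / h\<^sup>2)"

lemma powr_norm_near:
  fixes v w :: "'a::real_normed_vector"
  assumes "norm (w - v) \<le> norm v / 2" and "b \<le> 0" 
  shows "norm w powr b \<le> 2 powr (-b) * norm v powr b"
proof (cases "v = 0")
  case False
  have "norm v / 2 \<le> norm w" using assms(1) norm_triangle_ineq2[of v w] by (simp add: norm_minus_commute)
  then have "norm w powr b \<le> (norm v / 2) powr b"
    using False assms(2) by (intro powr_mono2') auto
  then show ?thesis by (simp add: powr_divide powr_minus field_simps)
qed (use assms in auto)

text \<open>
  For steps \<open>h \<le> \<bar>v\<bar> / 2\<close> the segments involved stay at distance at least \<open>\<bar>v\<bar> / 2\<close> from the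
  singularity, so the second derivatives there are at most a multiple of \<open>\<bar>v\<bar>\<close> to the power \<open>a - 2\<close>. The
  bound does not depend on \<open>h\<close> and serves as the majorant in the passage to the limit.
\<close>

lemma second_difference_kernel_bound:
  fixes v :: "'a::euclidean_space"
  assumes a: "a \<le> 0" and h: "0 < h" "h \<le> norm v / 2"
  shows "\<bar>second_difference_kernel a h v\<bar>
           \<le> DIM('a) * ((\<bar>a\<bar> + \<bar>a * (a - 2)\<bar>) * 2 powr (2 - a)) * norm v powr (a - 2)"
proof -
  have "\<bar>(norm (v + h *\<^sub>R e) powr a + norm (v - h *\<^sub>R e) powr a - 2 * norm v powr a) / h\<^sup>2\<bar>
      \<le> (\<bar>a\<bar> + \<bar>a * (a - 2)\<bar>) * 2 powr (2 - a) * norm v powr (a - 2)" if e: "e \<in> Basis" for e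
  proof -
    have ne: "norm e = 1" using e by simp
    define P where "P \<equiv> \<lambda>t. a * norm (v + t *\<^sub>R e) powr (a - 2)
                 + a * (a - 2) * (v \<bullet> e + t)\<^sup>2 * norm (v + t *\<^sub>R e) powr (a - 4)"
    have hv: "h < norm v" using h by linarith
    obtain p q where pq: "\<bar>p\<bar> \<le> h" "\<bar>q\<bar> \<le> h" and eq:
      "(norm (v + h *\<^sub>R e) powr a + norm (v - h *\<^sub>R e) powr a - 2 * norm v powr a) / h\<^sup>2 = (P p + P q) / 2"
      using second_difference_taylor[OF ne h(1) hv, of a] unfolding P_def by blast
    have P: "\<bar>P t\<bar> \<le> (\<bar>a\<bar> + \<bar>a * (a - 2)\<bar>) * 2 powr (2 - a) * norm v powr (a - 2)" if t: "\<bar>t\<bar> \<le> h" for t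
    proof -
      let ?w = "v + t *\<^sub>R e"
      have nz: "?w \<noteq> 0"
      proof
        assume "?w = 0"
        then have "norm v = norm (t *\<^sub>R e)" by (simp add: add_eq_0_iff)
        then show False using t h ne by auto
      qed
      have "v \<bullet> e + t = ?w \<bullet> e" using ne by (simp add: inner_add_left dot_square_norm)
      then have "\<bar>v \<bullet> e + t\<bar> \<le> norm ?w" using Cauchy_Schwarz_ineq2[of ?w e] ne by simp
      then have "(v \<bullet> e + t)\<^sup>2 \<le> norm ?w powr 2"
        using nz by (simp add: abs_le_square_iff[symmetric])
      then have "(v \<bullet> e + t)\<^sup>2 * norm ?w powr (a - 4) \<le> norm ?w powr 2 * norm ?w powr (a - 4)"
        by (rule mult_right_mono) simp
      also have "\<dots> = norm ?w powr (a - 2)" using nz by (simp add: powr_add[symmetric] del: powr_numeral)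
      finally have 1: "(v \<bullet> e + t)\<^sup>2 * norm ?w powr (a - 4) \<le> norm ?w powr (a - 2)" .
      have "\<bar>P t\<bar> \<le> \<bar>a\<bar> * norm ?w powr (a - 2) + \<bar>a * (a - 2)\<bar> * ((v \<bullet> e + t)\<^sup>2 * norm ?w powr (a - 4))"
        unfolding P_def by (rule order_trans[OF abs_triangle_ineq]) (simp add: abs_mult)
      also have "\<dots> \<le> \<bar>a\<bar> * norm ?w powr (a - 2) + \<bar>a * (a - 2)\<bar> * norm ?w powr (a - 2)"
        by (intro add_left_mono mult_left_mono 1) simp
      also have "\<dots> = (\<bar>a\<bar> + \<bar>a * (a - 2)\<bar>) * norm ?w powr (a - 2)" by (simp add: algebra_simps)
      also have "\<dots> \<le> (\<bar>a\<bar> + \<bar>a * (a - 2)\<bar>) * (2 powr (2 - a) * norm v powr (a - 2))"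
        using powr_norm_near[of ?w v "a - 2"] t h ne a by (intro mult_left_mono) auto
      finally show ?thesis by (simp add: mult_ac)
    qed
    show ?thesis unfolding eq using P[OF pq(1)] P[OF pq(2)]
        abs_triangle_ineq[of "P p" "P q"] by (simp only: abs_divide abs_numeral)
  qed
  then have "\<bar>second_difference_kernel a h v\<bar>
      \<le> (\<Sum>e\<in>(Basis::'a set). (\<bar>a\<bar> + \<bar>a * (a - 2)\<bar>) * 2 powr (2 - a) * norm v powr (a - 2))"
    unfolding second_difference_kernel_def by (intro order_trans[OF sum_abs] sum_mono)
  then show ?thesis by (simp add: mult_ac)
qed

text \<open>
  The limit is the Laplacian of \<open>\<bar>v\<bar>\<^sup>a\<close>: summing the second derivatives over an orthonormal basis
  turns \<open>\<Sum> (v \<bullet> e)\<^sup>2\<close> into \<open>\<bar>v\<bar>\<^sup>2\<close>, and what remains is a multiple of the next lower power.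
\<close>

lemma second_difference_kernel_tendsto:
  fixes v :: "'a::euclidean_space"
  assumes v: "v \<noteq> 0"
  shows "((\<lambda>h. second_difference_kernel a h v) \<longlongrightarrow>
           a * (a + DIM('a) - 2) * norm v powr (a - 2)) (at_right 0)"
proof -
  have one: "((\<lambda>h. (norm (v + h *\<^sub>R e) powr a + norm (v - h *\<^sub>R e) powr a - 2 * norm v powr a) / h\<^sup>2)
      \<longlongrightarrow> a * norm v powr (a - 2) + a * (a - 2) * (v \<bullet> e)\<^sup>2 * norm v powr (a - 4)) (at_right 0)"
    (is "(?D \<longlongrightarrow> ?L) _") if e: "e \<in> Basis" for e
  proof (rule tendstoI)
    fix \<epsilon> :: real assume \<epsilon>: "\<epsilon> > 0"
    have ne: "norm e = 1" using e by simp
    define P where "P \<equiv> \<lambda>t. a * norm (v + t *\<^sub>R e) powr (a - 2)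
                 + a * (a - 2) * (v \<bullet> e + t)\<^sup>2 * norm (v + t *\<^sub>R e) powr (a - 4)"
    have "isCont P 0" unfolding P_def using v by (intro continuous_intros) auto
    then obtain d where d: "d > 0" "\<And>t. \<bar>t\<bar> < d \<Longrightarrow> dist (P t) (P 0) < \<epsilon>"
      using \<epsilon> unfolding continuous_at_eps_delta by (auto simp: dist_real_def)
    have "eventually (\<lambda>h. h \<in> {0<..<min d (norm v)}) (at_right 0)"
      using d v by (intro eventually_at_right_real) auto
    then show "eventually (\<lambda>h. dist (?D h) ?L < \<epsilon>) (at_right 0)"
    proof eventually_elim
      case (elim h)
      then have h: "0 < h" "h < norm v" "h < d" by auto
      obtain p q where pq: "\<bar>p\<bar> \<le> h" "\<bar>q\<bar> \<le> h" and eq: "?D h = (P p + P q) / 2"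
        using second_difference_taylor[OF ne h(1,2), of a] unfolding P_def by blast
      have "dist (P p) (P 0) < \<epsilon>" "dist (P q) (P 0) < \<epsilon>" using d pq h by auto
      moreover have "P 0 = ?L" by (simp add: P_def)
      ultimately show ?case unfolding eq dist_real_def by argo
    qed
  qed
  have "((\<lambda>h. second_difference_kernel a h v) \<longlongrightarrow>
      (\<Sum>e\<in>Basis. a * norm v powr (a - 2) + a * (a - 2) * (v \<bullet> e)\<^sup>2 * norm v powr (a - 4))) (at_right 0)"
    unfolding second_difference_kernel_def by (intro tendsto_sum one)
  also have "(\<Sum>e\<in>Basis. a * norm v powr (a - 2) + a * (a - 2) * (v \<bullet> e)\<^sup>2 * norm v powr (a - 4))
     = DIM('a) * (a * norm v powr (a - 2)) + a * (a - 2) * ((\<Sum>e\<in>Basis. (v \<bullet> e)\<^sup>2) * norm v powr (a - 4))"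
    by (simp add: sum.distrib sum_distrib_left sum_distrib_right mult_ac)
  also have "(\<Sum>e\<in>Basis. (v \<bullet> e)\<^sup>2) = norm v powr 2"
    using v by (simp add: power2_norm_eq_inner euclidean_inner[of v v] power2_eq_square[of "_ \<bullet> _"])
  also have "norm v powr 2 * norm v powr (a - 4) = norm v powr (a - 2)"
    using v by (simp add: powr_add[symmetric] del: powr_numeral)
  finally show ?thesis by (simp add: algebra_simps)
qed

section \<open>From one vanishing potential to all Gaussian averages\<close>

text \<open>
  Near \<open>x\<close> the function vanishes, so only the decay of a radial weight matters, not its behaviour
  at the origin.
\<close>

lemma integrable_radial_weight:
  fixes g :: "'a::euclidean_space \<Rightarrow> complex" and \<phi> :: "real \<Rightarrow> real"
  assumes [measurable]: "g \<in> borel_measurable borel" "\<phi> \<in> borel_measurable borel"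
    and g0: "\<And>z. z \<in> ball x r \<Longrightarrow> g z = 0"
    and int: "integrable lborel (\<lambda>z. norm (z - x) powr a *\<^sub>R g z)"
    and bound: "\<And>t. r \<le> t \<Longrightarrow> \<bar>\<phi> t\<bar> \<le> C * t powr a"
  shows "integrable lborel (\<lambda>z. \<phi> (norm (z - x)) *\<^sub>R g z)"
proof (rule Bochner_Integration.integrable_bound)
  show "integrable lborel (\<lambda>z. C *\<^sub>R (norm (z - x) powr a *\<^sub>R g z))"
    using int by (rule integrable_scaleR_right)
  show "AE z in lborel. norm (\<phi> (norm (z - x)) *\<^sub>R g z) \<le> norm (C *\<^sub>R (norm (z - x) powr a *\<^sub>R g z))"
  proof (intro AE_I2)
    fix z
    show "norm (\<phi> (norm (z - x)) *\<^sub>R g z) \<le> norm (C *\<^sub>R (norm (z - x) powr a *\<^sub>R g z))"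
    proof (cases "z \<in> ball x r")
      case False
      then have "\<bar>\<phi> (norm (z - x))\<bar> \<le> C * norm (z - x) powr a"
        by (intro bound) (simp add: dist_norm norm_minus_commute)
      also have "\<dots> \<le> \<bar>C\<bar> * norm (z - x) powr a" by (intro mult_right_mono) auto
      finally have "\<bar>\<phi> (norm (z - x))\<bar> * norm (g z) \<le> \<bar>C\<bar> * norm (z - x) powr a * norm (g z)"
        by (rule mult_right_mono) simp
      then show ?thesis by (simp add: abs_mult)
    qed (simp add: g0)
  qed
qed measurable

lemma integrable_smaller_power:
  fixes g :: "'a::euclidean_space \<Rightarrow> complex"
  assumes [measurable]: "g \<in> borel_measurable borel"
    and "r > 0" and g0: "\<And>z. z \<in> ball x r \<Longrightarrow> g z = 0"
    and int: "integrable lborel (\<lambda>z. norm (z - x) powr a *\<^sub>R g z)" and ba: "b \<le> a"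
  shows "integrable lborel (\<lambda>z. norm (z - x) powr b *\<^sub>R g z)"
proof (rule integrable_radial_weight[where \<phi>="\<lambda>t. t powr b" and C="r powr (b - a)", OF _ _ g0 int])
  fix t assume t: "r \<le> t"
  have "t powr (b - a) \<le> r powr (b - a)" using t assms by (intro powr_mono2') auto
  then have "t powr (b - a) * t powr a \<le> r powr (b - a) * t powr a" by (rule mult_right_mono) simp
  then show "\<bar>t powr b\<bar> \<le> r powr (b - a) * t powr a" using t assms by (simp add: powr_add[symmetric])
qed (auto)

lemma AE_obtain_in_open:
  fixes V :: "'a::euclidean_space set"
  assumes "AE x in lborel. P x" "open V" "V \<noteq> {}"
  obtains x where "x \<in> V" "P x"
proof -
  have "\<exists>x\<in>V. P x"
  proof (rule ccontr)
    assume "\<not> ?thesis"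
    then have "AE x in lborel. x \<notin> V" using assms(1) by (rule_tac AE_mp) auto
    then have "V \<in> null_sets lborel" using assms(2) by (intro AE_iff_null_sets[THEN iffD2]) auto
    then have "V \<in> null_sets lebesgue" by (rule null_sets_completionI)
    then show False using open_not_negligible[OF assms(2,3)] by (simp add: negligible_iff_null_sets)
  qed
  then show thesis using that by blast
qed

text \<open>
  Since \<open>g\<close> vanishes on \<open>U\<close>, the kernel is only evaluated away from its singularity and the
  potential is continuous on \<open>U\<close>. A continuous function that vanishes almost everywhere on an open
  set vanishes on all of it.
\<close>

lemma potential_zero_on_open:
  fixes g :: "'a::euclidean_space \<Rightarrow> complex"
  assumes [measurable]: "g \<in> borel_measurable borel" and "open U"
    and g0: "\<And>z. z \<in> U \<Longrightarrow> g z = 0" and a: "a \<le> 0"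
    and int: "\<And>x. x \<in> U \<Longrightarrow> integrable lborel (\<lambda>z. norm (z - x) powr a *\<^sub>R g z)"
    and ae: "AE x in lborel. x \<in> U \<longrightarrow> (\<integral>z. norm (z - x) powr a *\<^sub>R g z \<partial>lborel) = 0"
    and x: "x \<in> U"
  shows "(\<integral>z. norm (z - x) powr a *\<^sub>R g z \<partial>lborel) = 0"
proof -
  obtain r where r: "r > 0" "ball x r \<subseteq> U" using \<open>open U\<close> x by (auto simp: open_contains_ball)
  have "\<exists>y. y \<in> ball x (r / 2 / real (Suc k)) \<and> (\<integral>z. norm (z - y) powr a *\<^sub>R g z \<partial>lborel) = 0" for k
  proof -
    have "0 < r / 2 / real (Suc k)" using r by simp
    then have "ball x (r / 2 / real (Suc k)) \<noteq> {}" by (simp only: ball_eq_empty not_le simp_thms)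
    then obtain y where y: "y \<in> ball x (r / 2 / real (Suc k))"
      "y \<in> U \<longrightarrow> (\<integral>z. norm (z - y) powr a *\<^sub>R g z \<partial>lborel) = 0"
      using AE_obtain_in_open[OF ae open_ball] by blast
    have "r / 2 / real (Suc k) \<le> r" using r by (simp add: field_simps)
    then have "y \<in> U" using y r by (meson subset_iff subset_ball)
    then show ?thesis using y by auto
  qed
  then obtain y where y: "\<And>k. y k \<in> ball x (r / 2 / real (Suc k))"
    "\<And>k. (\<integral>z. norm (z - y k) powr a *\<^sub>R g z \<partial>lborel) = 0" by metis
  have "(\<lambda>k. r / 2 / real (Suc k)) \<longlonglongrightarrow> 0" by real_asymp
  then have "(\<lambda>k. dist x (y k)) \<longlonglongrightarrow> 0"
    by (rule tendsto_sandwich[OF _ _ tendsto_const, rotated 2]) (use y(1) in \<open>auto simp: less_imp_le simp del: of_nat_Suc\<close>)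
  then have ylim: "y \<longlonglongrightarrow> x" by (subst tendsto_dist_iff) (simp add: dist_commute)
  have "(\<lambda>k. \<integral>z. norm (z - y k) powr a *\<^sub>R g z \<partial>lborel) \<longlonglongrightarrow> (\<integral>z. norm (z - x) powr a *\<^sub>R g z \<partial>lborel)"
  proof (rule integral_dominated_convergence[where w="\<lambda>z. 2 powr (-a) * norm (norm (z - x) powr a *\<^sub>R g z)"])
    show "integrable lborel (\<lambda>z. 2 powr (-a) * norm (norm (z - x) powr a *\<^sub>R g z))"
      by (intro integrable_mult_right integrable_norm int x)
    show "AE z in lborel. (\<lambda>k. norm (z - y k) powr a *\<^sub>R g z) \<longlonglongrightarrow> norm (z - x) powr a *\<^sub>R g z"
    proof (intro AE_I2)
      fix z
      show "(\<lambda>k. norm (z - y k) powr a *\<^sub>R g z) \<longlonglongrightarrow> norm (z - x) powr a *\<^sub>R g z"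
      proof (cases "z = x")
        case False
        then show ?thesis by (intro tendsto_intros ylim) auto
      qed (simp add: g0 x)
    qed
    show "AE z in lborel. norm (norm (z - y k) powr a *\<^sub>R g z) \<le> 2 powr (-a) * norm (norm (z - x) powr a *\<^sub>R g z)" for k
    proof (intro AE_I2)
      fix z
      show "norm (norm (z - y k) powr a *\<^sub>R g z) \<le> 2 powr (-a) * norm (norm (z - x) powr a *\<^sub>R g z)"
      proof (cases "z \<in> ball x r")
        case False
        have "dist x (y k) < r / 2 / real (Suc k)" using y(1)[of k] by simp
        also have "\<dots> \<le> r / 2" using r by (simp add: field_simps)
        finally have "norm (z - y k) powr a \<le> 2 powr (-a) * norm (z - x) powr a"
          using False a by (intro powr_norm_near) (auto simp: dist_norm norm_minus_commute)
        then have "norm (z - y k) powr a * norm (g z) \<le> 2 powr (-a) * norm (z - x) powr a * norm (g z)"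
          by (rule mult_right_mono) simp
        then show ?thesis by (simp add: mult_ac)
      qed (use r g0 in auto)
    qed
  qed measurable
  then show ?thesis using y(2) by (simp add: LIMSEQ_const_iff)
qed

text \<open>
  The discrete Laplacian of a potential vanishing on \<open>U\<close> is zero there, and in the limit it is
  \<open>a (a + n - 2)\<close> times the potential with exponent \<open>a - 2\<close>. The conditions on \<open>a\<close> make this
  factor non-zero; an exponent with \<open>a + n = 2\<close> belongs to the Newtonian kernel, which is harmonic
  away from the origin and gives no information.
\<close>

lemma potential_zero_laplacian:
  fixes g :: "'a::euclidean_space \<Rightarrow> complex" and a :: real
  assumes [measurable]: "g \<in> borel_measurable borel" and "open U"
    and g0: "\<And>z. z \<in> U \<Longrightarrow> g z = 0" and a: "a < 0" "a + DIM('a) \<noteq> 2"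
    and int: "\<And>x. x \<in> U \<Longrightarrow> integrable lborel (\<lambda>z. norm (z - x) powr a *\<^sub>R g z)"
    and zero: "\<And>x. x \<in> U \<Longrightarrow> (\<integral>z. norm (z - x) powr a *\<^sub>R g z \<partial>lborel) = 0"
    and x: "x \<in> U"
  shows "(\<integral>z. norm (z - x) powr (a - 2) *\<^sub>R g z \<partial>lborel) = 0"
proof -
  obtain r where r: "r > 0" "ball x r \<subseteq> U" using \<open>open U\<close> x by (auto simp: open_contains_ball)
  have hb: "has_bochner_integral lborel (\<lambda>z. norm (z - y) powr a *\<^sub>R g z) 0" if "y \<in> U" for y
    using int[OF that] zero[OF that] by (simp add: has_bochner_integral_iff)
  define h where "h \<equiv> \<lambda>k. r / 2 / real (Suc k)"
  have h: "h k > 0" "h k \<le> r / 2" for k using r by (auto simp: h_def field_simps)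
  have hlim: "filterlim h (at_right 0) sequentially"
    unfolding h_def using r by real_asymp
  let ?K = "\<lambda>k z. second_difference_kernel a (h k) (z - x) *\<^sub>R g z"
  have K0: "(\<integral>z. ?K k z \<partial>lborel) = 0" for k
  proof -
    have "has_bochner_integral lborel (\<lambda>z. \<Sum>e\<in>(Basis::'a set). (1 / (h k)\<^sup>2) *\<^sub>R
        (norm (z - (x - h k *\<^sub>R e)) powr a *\<^sub>R g z + norm (z - (x + h k *\<^sub>R e)) powr a *\<^sub>R g z
           - 2 *\<^sub>R (norm (z - x) powr a *\<^sub>R g z)))
        (\<Sum>e\<in>(Basis::'a set). (1 / (h k)\<^sup>2) *\<^sub>R (0 + 0 - 2 *\<^sub>R 0))"
    proof (intro has_bochner_integral_sum has_bochner_integral_scaleR_right has_bochner_integral_diff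
        has_bochner_integral_add hb x)
      fix e :: 'a assume e: "e \<in> Basis"
      show "x - h k *\<^sub>R e \<in> U" "x + h k *\<^sub>R e \<in> U"
        using h[of k] r e by (auto intro!: subsetD[OF r(2)] simp: dist_norm)
    qed
    then have "(\<integral>z. (\<Sum>e\<in>(Basis::'a set). (1 / (h k)\<^sup>2) *\<^sub>R
        (norm (z - (x - h k *\<^sub>R e)) powr a *\<^sub>R g z + norm (z - (x + h k *\<^sub>R e)) powr a *\<^sub>R g z
           - 2 *\<^sub>R (norm (z - x) powr a *\<^sub>R g z))) \<partial>lborel) = 0"
      using has_bochner_integral_integral_eq by fastforce
    moreover have "(\<Sum>e\<in>(Basis::'a set). (1 / (h k)\<^sup>2) *\<^sub>R
        (norm (z - (x - h k *\<^sub>R e)) powr a *\<^sub>R g z + norm (z - (x + h k *\<^sub>R e)) powr a *\<^sub>R g z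
           - 2 *\<^sub>R (norm (z - x) powr a *\<^sub>R g z))) = ?K k z" for z
      unfolding second_difference_kernel_def scaleR_sum_left
      by (intro sum.cong refl) (simp add: algebra_simps diff_divide_distrib add_divide_distrib)
    ultimately show ?thesis by simp
  qed
  define C where "C = DIM('a) * ((\<bar>a\<bar> + \<bar>a * (a - 2)\<bar>) * 2 powr (2 - a))"
  have int2: "integrable lborel (\<lambda>z. norm (z - x) powr (a - 2) *\<^sub>R g z)"
    using r g0 by (intro integrable_smaller_power[OF _ r(1) _ int[OF x]]) auto
  have "(\<lambda>k. \<integral>z. ?K k z \<partial>lborel) \<longlonglongrightarrow> (\<integral>z. (a * (a + DIM('a) - 2) * norm (z - x) powr (a - 2)) *\<^sub>R g z \<partial>lborel)"
  proof (rule integral_dominated_convergence[where w="\<lambda>z. C * norm (norm (z - x) powr (a - 2) *\<^sub>R g z)"])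
    show "integrable lborel (\<lambda>z. C * norm (norm (z - x) powr (a - 2) *\<^sub>R g z))"
      by (intro integrable_mult_right integrable_norm int2)
    show "AE z in lborel. (\<lambda>k. ?K k z) \<longlonglongrightarrow> (a * (a + DIM('a) - 2) * norm (z - x) powr (a - 2)) *\<^sub>R g z"
    proof (intro AE_I2)
      fix z
      show "(\<lambda>k. ?K k z) \<longlonglongrightarrow> (a * (a + DIM('a) - 2) * norm (z - x) powr (a - 2)) *\<^sub>R g z"
      proof (cases "z = x")
        case False
        then show ?thesis
          by (intro tendsto_scaleR tendsto_const
              filterlim_compose[OF second_difference_kernel_tendsto hlim]) auto
      qed (simp add: g0 x)
    qed
    show "AE z in lborel. norm (?K k z) \<le> C * norm (norm (z - x) powr (a - 2) *\<^sub>R g z)" for k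
    proof (intro AE_I2)
      fix z
      show "norm (?K k z) \<le> C * norm (norm (z - x) powr (a - 2) *\<^sub>R g z)"
      proof (cases "z \<in> ball x r")
        case False
        then have "h k \<le> norm (z - x) / 2"
          using h[of k] by (auto simp: dist_norm norm_minus_commute)
        then have "\<bar>second_difference_kernel a (h k) (z - x)\<bar> \<le> C * norm (z - x) powr (a - 2)"
          unfolding C_def using a h[of k] by (intro second_difference_kernel_bound) auto
        then have "\<bar>second_difference_kernel a (h k) (z - x)\<bar> * norm (g z) \<le> C * norm (z - x) powr (a - 2) * norm (g z)"
          by (rule mult_right_mono) simp
        then show ?thesis by (simp add: mult_ac)
      qed (use r g0 in auto)
    qed
    show "(\<lambda>z. ?K k z) \<in> borel_measurable lborel" for k
      unfolding second_difference_kernel_def by measurable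
  qed measurable
  then have "(\<integral>z. (a * (a + DIM('a) - 2) * norm (z - x) powr (a - 2)) *\<^sub>R g z \<partial>lborel) = 0"
    using K0 by (simp add: LIMSEQ_const_iff)
  then have "(a * (a + DIM('a) - 2)) *\<^sub>R (\<integral>z. norm (z - x) powr (a - 2) *\<^sub>R g z \<partial>lborel) = 0"
    by (simp flip: integral_scaleR_right)
  then show ?thesis using a by simp
qed

text \<open>
  The exponents \<open>a - 2 k\<close> are exactly those of \<open>\<bar>z - x\<bar>\<^sup>a\<close> times the monomials in
  \<open>u = \<bar>z - x\<bar>\<close> to the power \<open>-2\<close>. On the set where \<open>g\<close> is not known to vanish, \<open>u\<close> ranges over the
  compact interval from \<open>0\<close> to \<open>1 / r\<^sup>2\<close>, so by the Weierstrass theorem the polynomial \<open>p u\<close> can be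
  replaced by any continuous function of \<open>u\<close>; the error is controlled by the integrable function
  \<open>\<bar>z - x\<bar>\<^sup>a \<bar>g z\<bar>\<close>.
\<close>

lemma potential_zero_radial:
  fixes g :: "'a::euclidean_space \<Rightarrow> complex" and w :: "real \<Rightarrow> real"
  assumes [measurable]: "g \<in> borel_measurable borel"
    and r: "r > 0" and g0: "\<And>z. z \<in> ball x r \<Longrightarrow> g z = 0"
    and int: "integrable lborel (\<lambda>z. norm (z - x) powr a *\<^sub>R g z)"
    and zero: "\<And>k. (\<integral>z. norm (z - x) powr (a - 2 * real k) *\<^sub>R g z \<partial>lborel) = 0"
    and w: "continuous_on UNIV w"
  shows "integrable lborel (\<lambda>z. (norm (z - x) powr a * w (1 / (norm (z - x))\<^sup>2)) *\<^sub>R g z)" (is ?I)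
    and "(\<integral>z. (norm (z - x) powr a * w (1 / (norm (z - x))\<^sup>2)) *\<^sub>R g z \<partial>lborel) = 0" (is "?J = 0")
proof -
  have [measurable]: "w \<in> borel_measurable borel" using w by (rule borel_measurable_continuous_onI)
  have I: "integrable lborel (\<lambda>z. (norm (z - x) powr a * v (1 / (norm (z - x))\<^sup>2)) *\<^sub>R g z)"
    if v: "continuous_on UNIV v" for v :: "real \<Rightarrow> real"
  proof -
    have [measurable]: "v \<in> borel_measurable borel" using v by (rule borel_measurable_continuous_onI)
    have "bounded (v ` {0..1 / r\<^sup>2})"
      by (intro compact_imp_bounded compact_continuous_image continuous_on_subset[OF v]) auto
    then obtain C where C: "\<And>u. u \<in> {0..1 / r\<^sup>2} \<Longrightarrow> \<bar>v u\<bar> \<le> C"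
      unfolding bounded_iff real_norm_def by blast
    show ?thesis
    proof (rule integrable_radial_weight[where \<phi>="\<lambda>t. t powr a * v (1 / t\<^sup>2)" and C=C, OF _ _ g0 int])
      fix t assume "r \<le> t"
      then have "\<bar>v (1 / t\<^sup>2)\<bar> \<le> C" using r by (intro C) (auto intro!: divide_left_mono power_mono)
      then have "t powr a * \<bar>v (1 / t\<^sup>2)\<bar> \<le> t powr a * C" by (rule mult_left_mono) simp
      then show "\<bar>t powr a * v (1 / t\<^sup>2)\<bar> \<le> C * t powr a" by (simp add: abs_mult mult_ac)
    qed auto
  qed
  show ?I by (rule I[OF w])
  define M where "M = (\<integral>z. norm (norm (z - x) powr a *\<^sub>R g z) \<partial>lborel)"
  have "norm ?J \<le> \<epsilon> * M" if \<epsilon>: "\<epsilon> > 0" for \<epsilon>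
  proof -
    obtain p where p: "real_polynomial_function p" "\<And>u. u \<in> {0..1 / r\<^sup>2} \<Longrightarrow> \<bar>w u - p u\<bar> < \<epsilon>"
      using Stone_Weierstrass_real_polynomial_function[of "{0..1 / r\<^sup>2}" w \<epsilon>] \<epsilon> w
      by (metis compact_Icc continuous_on_subset subset_UNIV)
    obtain c n where cn: "p = (\<lambda>u. \<Sum>i\<le>n. c i * u ^ i)"
      using p(1) unfolding real_polynomial_function_iff_sum by blast
    have pc: "continuous_on UNIV p" unfolding cn by (intro continuous_intros)
    have "has_bochner_integral lborel (\<lambda>z. \<Sum>i\<le>n. c i *\<^sub>R (norm (z - x) powr (a - 2 * real i) *\<^sub>R g z))
       (\<Sum>i\<le>n. c i *\<^sub>R 0)"
    proof (intro has_bochner_integral_sum has_bochner_integral_scaleR_right)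
      show "has_bochner_integral lborel (\<lambda>z. norm (z - x) powr (a - 2 * real i) *\<^sub>R g z) 0" for i
        using integrable_smaller_power[OF _ r g0 int, of "a - 2 * real i"] zero[of i]
        by (simp add: has_bochner_integral_iff)
    qed
    then have "(\<integral>z. (\<Sum>i\<le>n. c i *\<^sub>R (norm (z - x) powr (a - 2 * real i) *\<^sub>R g z)) \<partial>lborel) = 0"
      using has_bochner_integral_integral_eq by fastforce
    moreover have "(\<Sum>i\<le>n. c i *\<^sub>R (norm (z - x) powr (a - 2 * real i) *\<^sub>R g z))
       = (norm (z - x) powr a * p (1 / (norm (z - x))\<^sup>2)) *\<^sub>R g z" for z
    proof (cases "z = x")
      case False
      have *: "norm (z - x) powr (a - 2 * real i) = norm (z - x) powr a * (1 / (norm (z - x))\<^sup>2) ^ i" for i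
      proof -
        have "norm (z - x) powr (2 * real i) = ((norm (z - x))\<^sup>2) ^ i"
          using False powr_realpow[of "norm (z - x)" "2 * i"] by (simp add: power_mult)
        then show ?thesis using False by (simp add: powr_diff power_divide)
      qed
      show ?thesis unfolding cn * by (simp add: sum_distrib_left scaleR_sum_left mult_ac)
    qed (use r in \<open>simp add: g0\<close>)
    ultimately have p0: "(\<integral>z. (norm (z - x) powr a * p (1 / (norm (z - x))\<^sup>2)) *\<^sub>R g z \<partial>lborel) = 0"
      by simp
    have "?J = (\<integral>z. (norm (z - x) powr a * w (1 / (norm (z - x))\<^sup>2)) *\<^sub>R g z
                  - (norm (z - x) powr a * p (1 / (norm (z - x))\<^sup>2)) *\<^sub>R g z \<partial>lborel)"
      using p0 by (subst Bochner_Integration.integral_diff[OF I[OF w] I[OF pc]]) simp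
    also have "norm \<dots> \<le> (\<integral>z. \<epsilon> * norm (norm (z - x) powr a *\<^sub>R g z) \<partial>lborel)"
    proof (rule order_trans[OF integral_norm_bound], rule integral_mono)
      show "integrable lborel (\<lambda>z. norm ((norm (z - x) powr a * w (1 / (norm (z - x))\<^sup>2)) *\<^sub>R g z
                  - (norm (z - x) powr a * p (1 / (norm (z - x))\<^sup>2)) *\<^sub>R g z))"
        by (intro integrable_norm Bochner_Integration.integrable_diff I w pc)
      show "integrable lborel (\<lambda>z. \<epsilon> * norm (norm (z - x) powr a *\<^sub>R g z))"
        by (intro integrable_mult_right integrable_norm int)
      fix z
      show "norm ((norm (z - x) powr a * w (1 / (norm (z - x))\<^sup>2)) *\<^sub>R g z
                  - (norm (z - x) powr a * p (1 / (norm (z - x))\<^sup>2)) *\<^sub>R g z)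
            \<le> \<epsilon> * norm (norm (z - x) powr a *\<^sub>R g z)"
      proof (cases "z \<in> ball x r")
        case False
        then have "r \<le> norm (z - x)" by (simp add: dist_norm norm_minus_commute)
        moreover have "0 < norm (z - x)" using \<open>r \<le> norm (z - x)\<close> r by linarith
        ultimately have "\<bar>w (1 / (norm (z - x))\<^sup>2) - p (1 / (norm (z - x))\<^sup>2)\<bar> \<le> \<epsilon>"
          using r by (intro less_imp_le p(2)) (auto intro!: divide_left_mono power_mono)
        then have "\<bar>w (1 / (norm (z - x))\<^sup>2) - p (1 / (norm (z - x))\<^sup>2)\<bar> * norm (norm (z - x) powr a *\<^sub>R g z)
             \<le> \<epsilon> * norm (norm (z - x) powr a *\<^sub>R g z)" by (rule mult_right_mono) simp
        moreover have "(norm (z - x) powr a * w (1 / (norm (z - x))\<^sup>2)) *\<^sub>R g z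
                  - (norm (z - x) powr a * p (1 / (norm (z - x))\<^sup>2)) *\<^sub>R g z
             = (w (1 / (norm (z - x))\<^sup>2) - p (1 / (norm (z - x))\<^sup>2)) *\<^sub>R (norm (z - x) powr a *\<^sub>R g z)"
          by (simp add: algebra_simps)
        ultimately show ?thesis by (simp add: abs_mult mult_ac)
      qed (simp add: g0)
    qed
    also have "\<dots> = \<epsilon> * M" by (simp add: M_def)
    finally show ?thesis .
  qed
  then have lim: "\<And>\<epsilon>. \<epsilon> > 0 \<Longrightarrow> norm ?J \<le> \<epsilon> * M" by blast
  have "((\<lambda>\<epsilon>. \<epsilon> * M) \<longlongrightarrow> 0 * M) (at_right 0)" by (intro tendsto_intros)
  then have "norm ?J \<le> 0 * M"
    by (rule tendsto_lowerbound) (auto simp: eventually_at_filter lim)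
  then show "?J = 0" by simp
qed

text \<open>
  This is \<open>exp (- c \<rho>\<^sup>2) / \<rho>\<^sup>a\<close> as a function of \<open>u = 1 / \<rho>\<^sup>2\<close>. The point \<open>u = 0\<close> corresponds to
  infinity, where the Gaussian decays faster than every power, so the extension by \<open>0\<close> is
  continuous whatever the sign of \<open>a\<close>.
\<close>

lemma gaussian_in_inverse_square_continuous:
  fixes a c :: real
  assumes c: "c > 0"
  shows "continuous_on UNIV (\<lambda>u. if u \<le> 0 then 0 else u powr (a / 2) * exp (- c / u))" (is "continuous_on _ ?w")
proof -
  have lim: "((\<lambda>u. u powr (a / 2) * exp (- c / u)) \<longlongrightarrow> 0) (at_right 0)" using c by real_asymp
  have "isCont ?w u" for u
  proof (cases u "0::real" rule: linorder_cases)
    case less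
    have "eventually (\<lambda>x. x < 0) (nhds u)" using less eventually_nhds_in_open[of "{..<0}" u] by auto
    then show ?thesis
      by (intro isCont_cong[THEN iffD2, OF _ continuous_const[of _ 0]]) (auto elim: eventually_mono)
  next
    case greater
    have "isCont (\<lambda>u. u powr (a / 2) * exp (- c / u)) u"
      using greater by (intro continuous_intros) auto
    moreover have "eventually (\<lambda>x. x > 0) (nhds u)" using greater eventually_nhds_in_open[of "{0<..}" u] by auto
    then have "eventually (\<lambda>x. ?w x = x powr (a / 2) * exp (- c / x)) (nhds u)"
      by (auto elim: eventually_mono)
    ultimately show ?thesis by (simp only: isCont_cong)
  next
    case equal
    have "(?w \<longlongrightarrow> 0) (at_left 0)"
      by (rule tendsto_eventually) (auto simp: eventually_at_filter)
    moreover have "(?w \<longlongrightarrow> 0) (at_right 0)"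
      by (rule Lim_transform_eventually[OF lim]) (auto simp: eventually_at_filter)
    ultimately show ?thesis unfolding isCont_def equal by (auto intro: filterlim_split_at)
  qed
  then show ?thesis by (simp add: continuous_on_eq_continuous_at)
qed

lemma gaussian_average_zero:
  fixes g :: "'a::euclidean_space \<Rightarrow> complex"
  assumes [measurable]: "g \<in> borel_measurable borel"
    and r: "r > 0" and g0: "\<And>z. z \<in> ball x r \<Longrightarrow> g z = 0"
    and int: "integrable lborel (\<lambda>z. norm (z - x) powr a *\<^sub>R g z)"
    and zero: "\<And>k. (\<integral>z. norm (z - x) powr (a - 2 * real k) *\<^sub>R g z \<partial>lborel) = 0"
    and c: "c > 0"
  shows "integrable lborel (\<lambda>z. exp (- c * (norm (z - x))\<^sup>2) *\<^sub>R g z)" 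
    and "(\<integral>z. exp (- c * (norm (z - x))\<^sup>2) *\<^sub>R g z \<partial>lborel) = 0"
proof -
  define w where "w \<equiv> \<lambda>u::real. if u \<le> 0 then 0 else u powr (a / 2) * exp (- c / u)"
  have w: "continuous_on UNIV w"
    unfolding w_def by (rule gaussian_in_inverse_square_continuous[OF c])
  have eq: "(norm (z - x) powr a * w (1 / (norm (z - x))\<^sup>2)) *\<^sub>R g z = exp (- c * (norm (z - x))\<^sup>2) *\<^sub>R g z" for z
  proof (cases "z = x")
    case False
    have "(1 / (norm (z - x))\<^sup>2) powr (a / 2) = norm (z - x) powr (- a)"
      using False by (simp add: powr_minus powr_divide powr_powr powr_numeral[symmetric] divide_simps del: powr_numeral)
    then have "norm (z - x) powr a * (1 / (norm (z - x))\<^sup>2) powr (a / 2) = 1"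
      using False by (simp add: powr_add[symmetric])
    then show ?thesis using False by (simp add: w_def mult.assoc[symmetric])
  qed (use r in \<open>simp add: g0\<close>)
  note * = potential_zero_radial[OF assms(1) r g0 int zero w, unfolded eq]
  show "integrable lborel (\<lambda>z. exp (- c * (norm (z - x))\<^sup>2) *\<^sub>R g z)" by (rule *(1))
  show "(\<integral>z. exp (- c * (norm (z - x))\<^sup>2) *\<^sub>R g z \<partial>lborel) = 0" by (rule *(2))
qed

lemma summable_integral_if_dominated:
  fixes u :: "nat \<Rightarrow> 'a \<Rightarrow> real"
  assumes "\<And>i. integrable M (u i)" "integrable M F" "\<And>i x. 0 \<le> u i x" "\<And>n x. (\<Sum>i<n. u i x) \<le> F x"
  shows "summable (\<lambda>i. \<integral>x. u i x \<partial>M)"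
proof (rule summableI_nonneg_bounded)
  show "0 \<le> (\<integral>x. u i x \<partial>M)" for i using assms(3) by (simp add: Bochner_Integration.integral_nonneg)
  fix n
  have "(\<Sum>i<n. \<integral>x. u i x \<partial>M) = (\<integral>x. (\<Sum>i<n. u i x) \<partial>M)"
    using assms(1) by (simp add: Bochner_Integration.integral_sum)
  also have "\<dots> \<le> (\<integral>x. F x \<partial>M)"
    using assms by (intro integral_mono Bochner_Integration.integrable_sum) auto
  finally show "(\<Sum>i<n. \<integral>x. u i x \<partial>M) \<le> (\<integral>x. F x \<partial>M)" .
qed

lemma exp_partial_sum_le:
  fixes x :: real assumes "0 \<le> x"
  shows "(\<Sum>i<n. x ^ i / fact i) \<le> exp x"
proof -
  have "(\<lambda>i. x ^ i / fact i) sums exp x" using exp_converges[of x] by (simp add: field_simps)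
  then show ?thesis using assms sum_le_suminf[of "\<lambda>i. x ^ i / fact i" "{..<n}"] by (auto simp: sums_iff)
qed

section \<open>Propagation to all centres\<close>

text \<open>
  Under the exponential integrability hypothesis the transform is given by a power series that
  converges for all complex parameters. If it vanishes on a real interval around \<open>0\<close>, isolation of
  zeros forces every coefficient to vanish.
\<close>

lemma exponential_transform_zero_extends:
  fixes h :: "'a \<Rightarrow> complex" and w :: "'a \<Rightarrow> real"
  assumes [measurable]: "h \<in> borel_measurable M" "w \<in> borel_measurable M"
    and int: "\<And>T. 0 \<le> T \<Longrightarrow> integrable M (\<lambda>y. exp (T * \<bar>w y\<bar>) *\<^sub>R h y)"
    and r: "0 < r" and zero: "\<And>t. \<bar>t\<bar> < r \<Longrightarrow> (\<integral>y. exp (t * w y) *\<^sub>R h y \<partial>M) = 0"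
  shows "(\<integral>y. exp (t * w y) *\<^sub>R h y \<partial>M) = 0"
proof -
  define f where "f \<equiv> \<lambda>\<zeta>::complex. \<integral>y. exp (\<zeta> * of_real (w y)) * h y \<partial>M"
  define a where "a \<equiv> \<lambda>k. (\<integral>y. of_real (w y ^ k / fact k) * h y \<partial>M)"
  have sums: "(\<lambda>k. a k * \<zeta> ^ k) sums f \<zeta>" for \<zeta>
  proof -
    define u where "u \<equiv> \<lambda>k y. (\<zeta> * of_real (w y)) ^ k / fact k * h y"
    have nu: "norm (u k y) = (norm \<zeta> * \<bar>w y\<bar>) ^ k / fact k * norm (h y)" for k y
      by (simp add: u_def norm_mult norm_divide norm_power)
    have partial: "(\<Sum>i<n. norm (u i y)) \<le> norm (exp (norm \<zeta> * \<bar>w y\<bar>) *\<^sub>R h y)" for n y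
      unfolding nu sum_distrib_right[symmetric] by (auto intro!: mult_right_mono exp_partial_sum_le)
    have dom: "integrable M (\<lambda>y. norm (exp (norm \<zeta> * \<bar>w y\<bar>) *\<^sub>R h y))"
      by (intro integrable_norm int) simp
    have ui: "integrable M (u k)" for k
    proof (rule Bochner_Integration.integrable_bound[OF dom])
      have "norm (u k y) \<le> norm (exp (norm \<zeta> * \<bar>w y\<bar>) *\<^sub>R h y)" for y
        using partial[where n="Suc k" and y=y] sum_nonneg[of "{..<k}" "\<lambda>i. norm (u i y)"] by simp
      then show "AE y in M. norm (u k y) \<le> norm (norm (exp (norm \<zeta> * \<bar>w y\<bar>) *\<^sub>R h y))" by simp
    qed (simp add: u_def)
    have us: "(\<lambda>k. u k y) sums (exp (\<zeta> * of_real (w y)) * h y)" for y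
      unfolding u_def using sums_mult2[OF exp_converges[of "\<zeta> * of_real (w y)"], of "h y"]
      by (simp add: scaleR_conv_of_real divide_inverse mult_ac)
    have "(\<lambda>k. \<integral>y. u k y \<partial>M) sums (\<integral>y. (\<Sum>k. u k y) \<partial>M)"
    proof (rule sums_integral[OF ui])
      show "AE y in M. summable (\<lambda>k. norm (u k y))"
        using partial by (intro AE_I2 summableI_nonneg_bounded) auto
      show "summable (\<lambda>k. \<integral>y. norm (u k y) \<partial>M)"
        by (rule summable_integral_if_dominated[OF integrable_norm[OF ui] dom _ partial]) simp
    qed
    moreover have "(\<integral>y. u k y \<partial>M) = a k * \<zeta> ^ k" for k
      unfolding a_def u_def integral_mult_left_zero[symmetric]
      by (intro Bochner_Integration.integral_cong refl) (simp add: power_mult_distrib)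
    ultimately show ?thesis using us by (simp add: f_def sums_iff)
  qed
  have f_real: "f (of_real t) = (\<integral>y. exp (t * w y) *\<^sub>R h y \<partial>M)" for t
    unfolding f_def by (simp add: scaleR_conv_of_real flip: of_real_mult exp_of_real)
  have f0: "f 0 = 0" using f_real[of 0] zero[of 0] r by simp
  have "a m = 0" for m
  proof (cases "m = 0")
    case True
    then show ?thesis using sums[of 0] f0 powser_sums_zero[of a] sums_unique2 by metis
  next
    case False
    show ?thesis
    proof (rule ccontr)
      assume "a m \<noteq> 0"
      then obtain s where s: "0 < s" "\<And>z. z \<in> cball 0 s - {0} \<Longrightarrow> f z \<noteq> 0"
        using powser_0_nonzero[of 1 0 a f m] sums f0 False by auto
      have "f (of_real (min s (r / 2))) \<noteq> 0" using s r by (intro s(2)) auto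
      then show False using zero[of "min s (r / 2)"] f_real[of "min s (r / 2)"] r s by auto
    qed
  qed
  then have "f (of_real t) = 0" using sums[of "of_real t"] by (simp add: sums_iff)
  then show ?thesis by (simp only: f_real)
qed

text \<open>
  Along the line \<open>x\<^sub>0 + t v\<close> the square in the Gaussian expands as
  \<open>\<bar>z - x\<^sub>0\<bar>\<^sup>2 - 2 t v \<bullet> (z - x\<^sub>0) + t\<^sup>2 \<bar>v\<bar>\<^sup>2\<close>. Up to a factor independent of \<open>z\<close>, the average at
  \<open>x\<^sub>0 + t v\<close> is therefore an exponential transform in \<open>t\<close>, which vanishes for small \<open>t\<close> and hence
  for \<open>t = 1\<close>.
\<close>

lemma gaussian_averages_zero_extend:
  fixes g :: "'a::euclidean_space \<Rightarrow> complex"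
  assumes [measurable]: "g \<in> borel_measurable borel" and r: "r > 0" and c: "c > 0"
    and int: "\<And>c. c > 0 \<Longrightarrow> integrable lborel (\<lambda>z. exp (- c * (norm (z - x\<^sub>0))\<^sup>2) *\<^sub>R g z)"
    and zero: "\<And>x. x \<in> ball x\<^sub>0 r \<Longrightarrow> (\<integral>z. exp (- c * (norm (z - x))\<^sup>2) *\<^sub>R g z \<partial>lborel) = 0"
  shows "(\<integral>z. exp (- c * (norm (z - x))\<^sup>2) *\<^sub>R g z \<partial>lborel) = 0"
proof -
  define v where "v = x - x\<^sub>0"
  define w where "w \<equiv> \<lambda>z. 2 * c * (v \<bullet> (z - x\<^sub>0))"
  define h where "h \<equiv> \<lambda>z. exp (- c * (norm (z - x\<^sub>0))\<^sup>2) *\<^sub>R g z"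
  have [measurable]: "w \<in> borel_measurable borel" "h \<in> borel_measurable borel"
    by (simp_all add: w_def h_def)
  have expand: "exp (- c * (norm (z - (x\<^sub>0 + t *\<^sub>R v)))\<^sup>2) *\<^sub>R g z
      = exp (- c * t\<^sup>2 * (norm v)\<^sup>2) *\<^sub>R (exp (t * w z) *\<^sub>R h z)" for t z
  proof -
    have "z - (x\<^sub>0 + t *\<^sub>R v) = (z - x\<^sub>0) - t *\<^sub>R v" by simp
    then have sq: "(norm (z - (x\<^sub>0 + t *\<^sub>R v)))\<^sup>2 = (norm (z - x\<^sub>0))\<^sup>2 - 2 * t * (v \<bullet> (z - x\<^sub>0)) + t\<^sup>2 * (norm v)\<^sup>2"
      by (simp only: power2_norm_eq_inner)
        (simp add: inner_diff_left inner_diff_right inner_commute power2_eq_square algebra_simps)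
    have "- c * (norm (z - (x\<^sub>0 + t *\<^sub>R v)))\<^sup>2
        = - c * t\<^sup>2 * (norm v)\<^sup>2 + (t * w z + - c * (norm (z - x\<^sub>0))\<^sup>2)"
      unfolding sq w_def by (simp add: algebra_simps)
    then show ?thesis by (simp only: h_def exp_add scaleR_scaleR mult.assoc)
  qed
  have "(\<integral>z. exp (1 * w z) *\<^sub>R h z \<partial>lborel) = 0"
  proof (rule exponential_transform_zero_extends[where r="r / (norm v + 1)"])
    show "0 < r / (norm v + 1)" using r by (simp add: add_nonneg_pos)
    fix t assume t: "\<bar>t\<bar> < r / (norm v + 1)"
    then have "\<bar>t\<bar> * (norm v + 1) < r" by (simp add: pos_less_divide_eq add_nonneg_pos)
    moreover have "\<bar>t\<bar> * norm v \<le> \<bar>t\<bar> * (norm v + 1)" by (intro mult_left_mono) auto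
    ultimately have "x\<^sub>0 + t *\<^sub>R v \<in> ball x\<^sub>0 r" by (simp add: dist_norm)
    then have "0 = (\<integral>z. exp (- c * (norm (z - (x\<^sub>0 + t *\<^sub>R v)))\<^sup>2) *\<^sub>R g z \<partial>lborel)"
      using zero by simp
    also have "\<dots> = (\<integral>z. exp (- c * t\<^sup>2 * (norm v)\<^sup>2) *\<^sub>R (exp (t * w z) *\<^sub>R h z) \<partial>lborel)"
      by (intro Bochner_Integration.integral_cong refl expand)
    also have "\<dots> = exp (- c * t\<^sup>2 * (norm v)\<^sup>2) *\<^sub>R (\<integral>z. exp (t * w z) *\<^sub>R h z \<partial>lborel)"
      by (rule integral_scaleR_right)
    finally show "(\<integral>z. exp (t * w z) *\<^sub>R h z \<partial>lborel) = 0" by simp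
  next
    fix T :: real assume T: "0 \<le> T"
    define K where "K = exp (2 * c * T\<^sup>2 * (norm v)\<^sup>2)"
    show "integrable lborel (\<lambda>z. exp (T * \<bar>w z\<bar>) *\<^sub>R h z)"
    proof (rule Bochner_Integration.integrable_bound)
      show "integrable lborel (\<lambda>z. K *\<^sub>R (exp (- (c / 2) * (norm (z - x\<^sub>0))\<^sup>2) *\<^sub>R g z))"
        using c by (intro integrable_scaleR_right int) simp
      show "AE z in lborel. norm (exp (T * \<bar>w z\<bar>) *\<^sub>R h z) \<le> norm (K *\<^sub>R (exp (- (c / 2) * (norm (z - x\<^sub>0))\<^sup>2) *\<^sub>R g z))"
      proof (intro AE_I2)
        fix z
        have "T * \<bar>w z\<bar> \<le> T * (2 * c * (norm v * norm (z - x\<^sub>0)))"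
          using T c Cauchy_Schwarz_ineq2[of v "z - x\<^sub>0"] by (auto simp: w_def abs_mult intro!: mult_left_mono)
        \<comment> \<open>Half of the Gaussian absorbs the exponential of a linear function.\<close>
        moreover have "0 \<le> c / 2 * (norm (z - x\<^sub>0) - 2 * T * norm v)\<^sup>2" using c by simp
        ultimately have "T * \<bar>w z\<bar> - c * (norm (z - x\<^sub>0))\<^sup>2 \<le> 2 * c * T\<^sup>2 * (norm v)\<^sup>2 - c / 2 * (norm (z - x\<^sub>0))\<^sup>2"
          by (simp add: power2_eq_square algebra_simps)
        then have "exp (T * \<bar>w z\<bar> - c * (norm (z - x\<^sub>0))\<^sup>2) * norm (g z)
            \<le> exp (2 * c * T\<^sup>2 * (norm v)\<^sup>2 - c / 2 * (norm (z - x\<^sub>0))\<^sup>2) * norm (g z)"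
          by (intro mult_right_mono) auto
        then show "norm (exp (T * \<bar>w z\<bar>) *\<^sub>R h z) \<le> norm (K *\<^sub>R (exp (- (c / 2) * (norm (z - x\<^sub>0))\<^sup>2) *\<^sub>R g z))"
          by (simp add: h_def K_def mult.assoc[symmetric] exp_add[symmetric])
      qed
    qed measurable
  qed measurable
  moreover have "(\<integral>z. exp (- c * (norm (z - (x\<^sub>0 + 1 *\<^sub>R v)))\<^sup>2) *\<^sub>R g z \<partial>lborel)
      = exp (- c * 1\<^sup>2 * (norm v)\<^sup>2) *\<^sub>R (\<integral>z. exp (1 * w z) *\<^sub>R h z \<partial>lborel)"
    unfolding integral_scaleR_right[symmetric] by (intro Bochner_Integration.integral_cong refl expand)
  ultimately show ?thesis by (simp add: v_def)
qed

section \<open>Integrability of powers and Gaussians\<close>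

lemma lborel_integral_affine:
  fixes f :: "'a::euclidean_space \<Rightarrow> 'b::{banach, second_countable_topology}" and c :: real
  assumes c: "c \<noteq> 0" and f: "integrable lborel f"
  shows "integrable lborel (\<lambda>x. f (t + c *\<^sub>R x))"
    and "(\<integral>x. f x \<partial>lborel) = \<bar>c\<bar> ^ DIM('a) *\<^sub>R (\<integral>x. f (t + c *\<^sub>R x) \<partial>lborel)"
proof -
  note eq = lborel_affine[OF c, of t]
  have [measurable]: "f \<in> borel_measurable borel" using f by auto
  have "integrable (density (distr lborel borel (\<lambda>x. t + c *\<^sub>R x)) (\<lambda>_. ennreal (\<bar>c\<bar> ^ DIM('a)))) f"
    using f by (simp only: eq[symmetric])
  then have "integrable lborel (\<lambda>x. \<bar>c\<bar> ^ DIM('a) *\<^sub>R f (t + c *\<^sub>R x))"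
    by (simp add: integrable_density integrable_distr_eq)
  from integrable_scaleR_right[OF this, of "1 / \<bar>c\<bar> ^ DIM('a)"]
  show "integrable lborel (\<lambda>x. f (t + c *\<^sub>R x))" using c by simp
  have "(\<integral>x. f x \<partial>lborel) = (\<integral>x. f x \<partial>density (distr lborel borel (\<lambda>x. t + c *\<^sub>R x)) (\<lambda>_. ennreal (\<bar>c\<bar> ^ DIM('a))))"
    by (simp only: eq[symmetric])
  then show "(\<integral>x. f x \<partial>lborel) = \<bar>c\<bar> ^ DIM('a) *\<^sub>R (\<integral>x. f (t + c *\<^sub>R x) \<partial>lborel)"
    by (simp add: integral_density integral_distr)
qed

text \<open>
  On the dyadic shell \<open>2\<^sup>k r \<le> \<bar>z\<bar> < 2 2\<^sup>k r\<close> the integrand is at most its value on the inner sphere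
  and the volume is at most that of the outer ball. The products form a geometric series with ratio
  2 to the power \<open>b + n\<close>, which is less than 1.
\<close>

lemma integrable_power_off_ball:
  assumes b: "b < - real DIM('a)" and r: "r > 0"
  shows "integrable lborel (\<lambda>z::'a::euclidean_space. indicator (- ball 0 r) z * norm z powr b)"
proof (rule integrableI_nonneg)
  let ?n = "DIM('a)"
  let ?q = "2 powr (b + real ?n)"
  define C where "C = r powr b * (unit_ball_vol ?n * (2 * r) ^ ?n)"
  have C: "C \<ge> 0" using r by (simp add: C_def)
  have "(\<integral>\<^sup>+(z::'a). ennreal (indicator (- ball 0 r) z * norm z powr b) \<partial>lborel)
      \<le> (\<integral>\<^sup>+(z::'a). (\<Sum>k. ennreal ((2 ^ k * r) powr b) * indicator (ball 0 (2 ^ Suc k * r)) z) \<partial>lborel)"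
  proof (intro nn_integral_mono)
    fix z :: 'a
    show "ennreal (indicator (- ball 0 r) z * norm z powr b)
      \<le> (\<Sum>k. ennreal ((2 ^ k * r) powr b) * indicator (ball 0 (2 ^ Suc k * r)) z)"
    proof (cases "z \<in> ball 0 r")
      case False
      then have z: "r \<le> norm z" by simp
      obtain m where m: "norm z / r < 2 ^ m" using real_arch_pow[of 2 "norm z / r"] by auto
      then have "norm z < 2 ^ m * r" using r by (simp add: field_simps)
      also have "\<dots> \<le> 2 ^ Suc m * r" using r by simp
      finally have "norm z < 2 ^ Suc m * r" .
      then have ex: "\<exists>k. norm z < 2 ^ Suc k * r" by blast
      define k where "k = (LEAST k. norm z < 2 ^ Suc k * r)"
      have k1: "norm z < 2 ^ Suc k * r" unfolding k_def using ex by (rule LeastI_ex)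
      have k2: "2 ^ k * r \<le> norm z"
      proof (cases k)
        case (Suc j)
        have "\<not> norm z < 2 ^ Suc j * r"
          using not_less_Least[of j "\<lambda>k. norm z < 2 ^ Suc k * r"] Suc unfolding k_def by simp
        then show ?thesis using Suc by simp
      qed (use z in simp)
      have "norm z powr b \<le> (2 ^ k * r) powr b" using r k2 b by (intro powr_mono2') auto
      moreover have "indicator (- ball 0 r) z = (1::real)" using False by simp
      moreover have "indicator (ball 0 (2 ^ Suc k * r)) z = (1::ennreal)" using k1 by (simp del: power_Suc)
      ultimately have "ennreal (indicator (- ball 0 r) z * norm z powr b)
          \<le> ennreal ((2 ^ k * r) powr b) * indicator (ball 0 (2 ^ Suc k * r)) z"
        by (simp only: mult_1_left mult_1_right ennreal_leI)
      also have "\<dots> \<le> (\<Sum>k. ennreal ((2 ^ k * r) powr b) * indicator (ball 0 (2 ^ Suc k * r)) z)"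
        (is "?u k \<le> suminf ?u")
      proof -
        have "u k \<le> suminf u" for u :: "nat \<Rightarrow> ennreal"
          using sum_le_suminf[of u "{k}"] by simp
        then show ?thesis by (rule meta_spec)
      qed
      finally show ?thesis .
    qed simp
  qed
  also have "\<dots> = (\<Sum>k. ennreal ((2 ^ k * r) powr b) * emeasure lborel (ball (0::'a) (2 ^ Suc k * r)))"
  proof (subst nn_integral_suminf)
    show "(\<lambda>z::'a. ennreal ((2 ^ k * r) powr b) * indicator (ball 0 (2 ^ Suc k * r)) z) \<in> borel_measurable lborel" for k
      by (intro borel_measurable_times_ennreal borel_measurable_const borel_measurable_indicator) (simp only: sets_lborel borel_open open_ball)
  next
    show "(\<Sum>k. \<integral>\<^sup>+(z::'a). ennreal ((2 ^ k * r) powr b) * indicator (ball 0 (2 ^ Suc k * r)) z \<partial>lborel)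
      = (\<Sum>k. ennreal ((2 ^ k * r) powr b) * emeasure lborel (ball (0::'a) (2 ^ Suc k * r)))"
      by (intro arg_cong[where f=suminf] ext nn_integral_cmult_indicator) (simp only: sets_lborel borel_open open_ball)
  qed
  also have "\<dots> = (\<Sum>k. ennreal (C * ?q ^ k))"
  proof (intro arg_cong[where f=suminf] ext)
    fix k
    have "(2 ^ k :: real) powr b = (2 powr b) ^ k" by (induction k) (auto simp: powr_mult)
    then have p1: "(2 ^ k * r) powr b = (2 powr b) ^ k * r powr b" using r by (subst powr_mult) auto
    have "(2 ^ k :: real) ^ ?n = (2 ^ ?n) ^ k"
      unfolding power_mult[symmetric] by (simp only: mult.commute)
    moreover have "2 ^ Suc k * r = 2 ^ k * (2 * r)" by simp
    ultimately have p2: "(2 ^ Suc k * r) ^ ?n = (2 ^ ?n) ^ k * (2 * r) ^ ?n"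
      by (simp only: power_mult_distrib)
    have p3: "?q ^ k = (2 powr b) ^ k * (2 ^ ?n) ^ k"
      unfolding powr_add power_mult_distrib by (simp only: powr_realpow zero_less_numeral)
    have "(2 ^ k * r) powr b * (unit_ball_vol ?n * (2 ^ Suc k * r) ^ ?n) = C * ?q ^ k"
      unfolding p1 p2 p3 C_def by (simp only: mult_ac)
    then show "ennreal ((2 ^ k * r) powr b) * emeasure lborel (ball (0::'a) (2 ^ Suc k * r)) = ennreal (C * ?q ^ k)"
      using r by (subst emeasure_ball) (simp_all add: ennreal_mult[symmetric])
  qed
  also have "\<dots> < \<infinity>"
  proof -
    have "2 powr (b + real ?n) < 2 powr 0" using b by (intro powr_less_mono) auto
    then have "summable (\<lambda>k. C * ?q ^ k)" by (intro summable_mult summable_geometric) simp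
    then show ?thesis using C by (subst suminf_ennreal2) auto
  qed
  finally show "(\<integral>\<^sup>+(z::'a). ennreal (indicator (- ball 0 r) z * norm z powr b) \<partial>lborel) < \<infinity>" .
qed auto

lemma integrable_gaussian:
  "integrable lborel (\<lambda>z::'a::euclidean_space. exp (- (norm z)\<^sup>2))"
proof -
  \<comment> \<open>The Taylor term of degree \<open>n\<close> of the exponential makes the Gaussian smaller than a multiple
    of \<open>1 / \<bar>z\<bar>\<close> to the power \<open>2 n\<close>, and \<open>2 n > n\<close>.\<close>
  let ?n = "DIM('a)"
  have near: "integrable lborel (\<lambda>z::'a. indicator (ball 0 1) z :: real)"
    by (intro integrable_real_indicator) (auto simp: emeasure_ball)
  have "integrable lborel (\<lambda>z::'a. indicator (- ball 0 1) z * norm z powr (- real (2 * ?n)))"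
    by (intro integrable_power_off_ball) (auto simp: DIM_positive)
  then have far: "integrable lborel (\<lambda>z::'a. fact ?n * (indicator (- ball 0 1) z * norm z powr (- real (2 * ?n))))"
    by (rule integrable_mult_right)
  show ?thesis
  proof (rule Bochner_Integration.integrable_bound[OF Bochner_Integration.integrable_add[OF near far]])
    show "AE z::'a in lborel. norm (exp (- (norm z)\<^sup>2)) \<le> norm (indicator (ball 0 1) z
        + fact ?n * (indicator (- ball 0 1) z * norm z powr (- real (2 * ?n))))"
    proof (intro AE_I2)
      fix z :: 'a
      show "norm (exp (- (norm z)\<^sup>2)) \<le> norm (indicator (ball 0 1) z
        + fact ?n * (indicator (- ball 0 1) z * norm z powr (- real (2 * ?n))))"
      proof (cases "z \<in> ball 0 1")
        case False
        then have z: "norm z \<ge> 1" by simp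
        have "((norm z)\<^sup>2) ^ ?n / fact ?n \<le> exp ((norm z)\<^sup>2)"
          using exp_partial_sum_le[of "(norm z)\<^sup>2" "Suc ?n"]
            sum_nonneg[of "{..<?n}" "\<lambda>i. ((norm z)\<^sup>2) ^ i / fact i"] by simp
        moreover have "((norm z)\<^sup>2) ^ ?n = norm z powr real (2 * ?n)"
          using z by (subst powr_realpow) (auto simp: power_mult)
        ultimately have "norm z powr real (2 * ?n) / fact ?n \<le> exp ((norm z)\<^sup>2)" by (simp only:)
        moreover have "0 < norm z powr real (2 * ?n)" using z by auto
        ultimately have "exp (- (norm z)\<^sup>2) \<le> fact ?n * norm z powr (- real (2 * ?n))"
          unfolding exp_minus powr_minus by (simp add: field_simps)
        then show ?thesis using False by simp
      qed simp
    qed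
  qed measurable
qed

section \<open>Gaussian averages determine an integrable function\<close>

text \<open>
  The inner integral is, after rescaling, the convolution of \<open>\<phi>\<close> with a Gaussian of width \<open>1 / l\<close>.
  By Fubini the Gaussian can be moved from \<open>\<phi>\<close> to \<open>h\<close>, where its averages vanish.
\<close>

lemma gaussian_smoothing_annihilates:
  fixes h :: "'a::euclidean_space \<Rightarrow> complex" and \<phi> :: "'a \<Rightarrow> real"
  assumes h: "integrable lborel h" and \<phi> [measurable]: "\<phi> \<in> borel_measurable borel"
    and B: "\<And>x. \<bar>\<phi> x\<bar> \<le> B" and l: "l > 0"
    and zero: "\<And>x. (\<integral>z. exp (- l\<^sup>2 * (norm (z - x))\<^sup>2) *\<^sub>R h z \<partial>lborel) = 0"
  shows "(\<integral>y. (\<integral>z. \<phi> (y + (1 / l) *\<^sub>R z) * exp (- (norm z)\<^sup>2) \<partial>lborel) *\<^sub>R h y \<partial>lborel) = 0"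
proof -
  let ?n = "DIM('a)"
  define G where "G \<equiv> \<lambda>y x::'a. exp (- l\<^sup>2 * (norm (y - x))\<^sup>2)"
  have [measurable]: "h \<in> borel_measurable borel" using h by auto
  have rescale: "integrable lborel (\<lambda>x. \<psi> x * G y x)"
      "(\<integral>z. \<psi> (y + (1 / l) *\<^sub>R z) * exp (- (norm z)\<^sup>2) \<partial>lborel) = l ^ ?n * (\<integral>x. \<psi> x * G y x \<partial>lborel)"
    if [measurable]: "\<psi> \<in> borel_measurable borel" and bnd: "\<And>x. \<bar>\<psi> x\<bar> \<le> K" for \<psi> :: "'a \<Rightarrow> real" and K y
  proof -
    have "integrable lborel (\<lambda>z. \<psi> (y + (1 / l) *\<^sub>R z) * exp (- (norm z)\<^sup>2))"
    proof (rule Bochner_Integration.integrable_bound)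
      show "integrable lborel (\<lambda>z::'a. K * exp (- (norm z)\<^sup>2))"
        by (intro integrable_mult_right integrable_gaussian)
      show "AE z in lborel. norm (\<psi> (y + (1 / l) *\<^sub>R z) * exp (- (norm z)\<^sup>2)) \<le> norm (K * exp (- (norm z)\<^sup>2))"
        using order_trans[OF bnd abs_ge_self] by (intro AE_I2) (simp add: abs_mult)
    qed measurable
    note * = lborel_integral_affine[OF _ this, of l "- l *\<^sub>R y"]
    have "\<psi> (y + (1 / l) *\<^sub>R (- l *\<^sub>R y + l *\<^sub>R x)) * exp (- (norm (- l *\<^sub>R y + l *\<^sub>R x))\<^sup>2) = \<psi> x * G y x" for x
    proof -
      have "- l *\<^sub>R y + l *\<^sub>R x = - l *\<^sub>R (y - x)" by (simp add: algebra_simps)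
      then have "norm (- l *\<^sub>R y + l *\<^sub>R x) = l * norm (y - x)" using l by (simp only: norm_scaleR abs_minus_cancel abs_of_pos)
      moreover have "y + (1 / l) *\<^sub>R (- l *\<^sub>R y + l *\<^sub>R x) = x" using l by (simp add: algebra_simps)
      ultimately show ?thesis by (simp add: G_def power_mult_distrib)
    qed
    note ** = *[unfolded this]
    show "integrable lborel (\<lambda>x. \<psi> x * G y x)" using **(1) l by simp
    show "(\<integral>z. \<psi> (y + (1 / l) *\<^sub>R z) * exp (- (norm z)\<^sup>2) \<partial>lborel) = l ^ ?n * (\<integral>x. \<psi> x * G y x \<partial>lborel)"
      using **(2) l by simp
  qed
  define M where "M = (\<integral>(z::'a). exp (- (norm z)\<^sup>2) \<partial>lborel)"
  have massG: "(\<integral>x. G y x \<partial>lborel) = M / l ^ ?n" for y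
    using rescale(2)[of "\<lambda>_. 1" 1 y] l by (simp add: M_def field_simps)
  have intG: "integrable lborel (\<lambda>x. G y x)" for y
    using rescale(1)[of "\<lambda>_. 1" 1 y] by simp
  have [measurable]: "case_prod G \<in> borel_measurable (lborel \<Otimes>\<^sub>M lborel)"
    unfolding G_def by measurable
  have "integrable (lborel \<Otimes>\<^sub>M lborel) (\<lambda>(y, x). G y x *\<^sub>R h y)"
  proof (rule lborel_pair.Fubini_integrable)
    have "(\<lambda>y. \<integral>x. norm (case (y, x) of (y, x) \<Rightarrow> G y x *\<^sub>R h y) \<partial>lborel) = (\<lambda>y. M / l ^ ?n * norm (h y))"
      using massG by (auto simp: G_def)
    then show "integrable lborel (\<lambda>y. \<integral>x. norm (case (y, x) of (y, x) \<Rightarrow> G y x *\<^sub>R h y) \<partial>lborel)"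
      using h by simp
    show "AE y in lborel. integrable lborel (\<lambda>x. case (y, x) of (y, x) \<Rightarrow> G y x *\<^sub>R h y)"
      using intG by simp
  qed measurable
  then have "integrable (lborel \<Otimes>\<^sub>M lborel) (\<lambda>p. B *\<^sub>R (case p of (y, x) \<Rightarrow> G y x *\<^sub>R h y))"
    by (rule integrable_scaleR_right)
  then have int: "integrable (lborel \<Otimes>\<^sub>M lborel) (\<lambda>(y, x). (\<phi> x * G y x) *\<^sub>R h y)"
  proof (rule Bochner_Integration.integrable_bound)
    show "AE p in lborel \<Otimes>\<^sub>M lborel. norm (case p of (y, x) \<Rightarrow> (\<phi> x * G y x) *\<^sub>R h y)
        \<le> norm (B *\<^sub>R (case p of (y, x) \<Rightarrow> G y x *\<^sub>R h y))"
      using order_trans[OF B abs_ge_self]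
      by (intro AE_I2) (auto simp: abs_mult mult.assoc intro!: mult_right_mono)
  qed measurable
  have inner: "(\<integral>x. (\<phi> x * G y x) *\<^sub>R h y \<partial>lborel) = (\<integral>x. \<phi> x * G y x \<partial>lborel) *\<^sub>R h y" for y
    by (rule integral_scaleR_left[OF rescale(1)[OF \<phi> B]])
  have "(\<integral>y. (\<integral>z. \<phi> (y + (1 / l) *\<^sub>R z) * exp (- (norm z)\<^sup>2) \<partial>lborel) *\<^sub>R h y \<partial>lborel)
      = l ^ ?n *\<^sub>R (\<integral>y. (\<integral>x. (\<phi> x * G y x) *\<^sub>R h y \<partial>lborel) \<partial>lborel)"
    unfolding inner rescale(2)[OF \<phi> B] integral_scaleR_right[symmetric] by (simp only: scaleR_scaleR)
  also have "(\<integral>y. (\<integral>x. (\<phi> x * G y x) *\<^sub>R h y \<partial>lborel) \<partial>lborel)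
      = (\<integral>x. (\<integral>y. (\<phi> x * G y x) *\<^sub>R h y \<partial>lborel) \<partial>lborel)"
    by (rule lborel_pair.Fubini_integral[OF int, symmetric])
  also have "\<dots> = (\<integral>x. \<phi> x *\<^sub>R (\<integral>y. G y x *\<^sub>R h y \<partial>lborel) \<partial>lborel)"
    by (simp flip: integral_scaleR_right)
  also have "\<dots> = 0" using zero by (simp add: G_def)
  finally show ?thesis by simp
qed

text \<open>
  As the width tends to \<open>0\<close>, the smoothed test functions converge to a positive multiple of \<open>\<phi>\<close>
  pointwise and boundedly; the multiple is the total mass \<open>M\<close> of the unnormalised Gaussian.
\<close>

lemma gaussian_averages_zero_test:
  fixes h :: "'a::euclidean_space \<Rightarrow> complex" and \<phi> :: "'a \<Rightarrow> real"
  assumes h: "integrable lborel h" and \<phi>: "continuous_on UNIV \<phi>" and B: "\<And>x. \<bar>\<phi> x\<bar> \<le> B"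
    and zero: "\<And>c x. c > 0 \<Longrightarrow> (\<integral>z. exp (- c * (norm (z - x))\<^sup>2) *\<^sub>R h z \<partial>lborel) = 0"
  shows "(\<integral>y. \<phi> y *\<^sub>R h y \<partial>lborel) = 0"
proof -
  have [measurable]: "\<phi> \<in> borel_measurable borel" using \<phi> by (rule borel_measurable_continuous_onI)
  have [measurable]: "h \<in> borel_measurable borel" using h by auto
  define M where "M = (\<integral>(z::'a). exp (- (norm z)\<^sup>2) \<partial>lborel)"
  have M: "M > 0"
  proof -
    have "M \<noteq> 0"
    proof
      assume "M = 0"
      then have "AE z::'a in lborel. exp (- (norm z)\<^sup>2) = 0"
        unfolding M_def by (subst (asm) integral_nonneg_eq_0_iff_AE) (auto intro: integrable_gaussian)
      then have "AE z::'a in lborel. False" by simp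
      then show False using AE_obtain_in_open[of "\<lambda>_. False" UNIV] by auto
    qed
    moreover have "M \<ge> 0" unfolding M_def by (intro Bochner_Integration.integral_nonneg) simp
    ultimately show ?thesis by simp
  qed
  define S where "S \<equiv> \<lambda>k y. \<integral>z. \<phi> (y + (1 / real (Suc k)) *\<^sub>R z) * exp (- (norm z)\<^sup>2) \<partial>lborel"
  have Gb: "norm (\<phi> x * exp (- (norm z)\<^sup>2)) \<le> B * exp (- (norm z)\<^sup>2)" for x and z :: 'a
    using B by (simp add: abs_mult)
  have BG: "integrable lborel (\<lambda>z::'a. B * exp (- (norm z)\<^sup>2))"
    by (intro integrable_mult_right integrable_gaussian)
  have S_lim: "(\<lambda>k. S k y) \<longlonglongrightarrow> \<phi> y * M" for y
  proof -
    have "(\<lambda>k. S k y) \<longlonglongrightarrow> (\<integral>z. \<phi> y * exp (- (norm z)\<^sup>2) \<partial>(lborel :: 'a measure))"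
      unfolding S_def
    proof (rule integral_dominated_convergence[OF _ _ BG])
      show "AE z in lborel. (\<lambda>k. \<phi> (y + (1 / real (Suc k)) *\<^sub>R z) * exp (- (norm z)\<^sup>2)) \<longlonglongrightarrow> \<phi> y * exp (- (norm z)\<^sup>2)"
      proof (intro AE_I2 tendsto_mult tendsto_const)
        fix z
        have "(\<lambda>k. 1 / real (Suc k)) \<longlonglongrightarrow> 0" by real_asymp
        then have "(\<lambda>k. y + (1 / real (Suc k)) *\<^sub>R z) \<longlonglongrightarrow> y + 0 *\<^sub>R z" by (intro tendsto_intros)
        then show "(\<lambda>k. \<phi> (y + (1 / real (Suc k)) *\<^sub>R z)) \<longlonglongrightarrow> \<phi> y"
          using \<phi> by (intro continuous_on_tendsto_compose[OF \<phi>]) auto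
      qed
    qed (use Gb in auto)
    then show ?thesis by (simp add: M_def)
  qed
  have S_bound: "\<bar>S k y\<bar> \<le> B * M" for k y
  proof -
    have "norm (S k y) \<le> (\<integral>z. B * exp (- (norm z)\<^sup>2) \<partial>(lborel :: 'a measure))"
      unfolding S_def
    proof (rule order_trans[OF integral_norm_bound], rule integral_mono[OF _ BG])
      show "integrable lborel (\<lambda>z. norm (\<phi> (y + (1 / real (Suc k)) *\<^sub>R z) * exp (- (norm z)\<^sup>2)))"
      proof (intro integrable_norm Bochner_Integration.integrable_bound[OF BG] AE_I2)
        show "norm (\<phi> (y + (1 / real (Suc k)) *\<^sub>R z) * exp (- (norm z)\<^sup>2)) \<le> norm (B * exp (- (norm z)\<^sup>2))" for z
          by (rule order_trans[OF Gb]) (simp only: real_norm_def abs_ge_self)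
      qed measurable
    qed (use Gb in auto)
    then show ?thesis by (simp add: M_def)
  qed
  have [measurable]: "S k \<in> borel_measurable borel" for k unfolding S_def by measurable
  have "(\<lambda>k. \<integral>y. S k y *\<^sub>R h y \<partial>lborel) \<longlonglongrightarrow> (\<integral>y. (\<phi> y * M) *\<^sub>R h y \<partial>lborel)"
  proof (rule integral_dominated_convergence[where w="\<lambda>y. (B * M) * norm (h y)"])
    show "AE y in lborel. norm (S k y *\<^sub>R h y) \<le> B * M * norm (h y)" for k
      using S_bound by (intro AE_I2) (auto intro!: mult_right_mono)
    show "AE y in lborel. (\<lambda>k. S k y *\<^sub>R h y) \<longlonglongrightarrow> (\<phi> y * M) *\<^sub>R h y"
      by (intro AE_I2 tendsto_intros S_lim)
  qed (use h in auto)
  moreover have "(\<integral>y. S k y *\<^sub>R h y \<partial>lborel) = 0" for k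
    unfolding S_def using zero by (intro gaussian_smoothing_annihilates[OF h _ B]) auto
  ultimately have "(\<integral>y. (\<phi> y * M) *\<^sub>R h y \<partial>lborel) = 0" by (simp add: LIMSEQ_const_iff)
  then have "M *\<^sub>R (\<integral>y. \<phi> y *\<^sub>R h y \<partial>lborel) = 0"
    by (simp add: mult.commute flip: integral_scaleR_right)
  then show ?thesis using M by simp
qed

text \<open>
  For a closed set \<open>C\<close> the functions \<open>exp (- k dist(y, C))\<close> decrease to the indicator of \<open>C\<close>, so the
  integral of \<open>h\<close> over every closed set is zero. Closed sets are stable under intersection and
  generate the Borel sets, hence the integral over every Borel set is zero.
\<close>

lemma AE_zero_if_orthogonal_to_continuous:
  fixes h :: "'a::euclidean_space \<Rightarrow> complex"
  assumes h: "integrable lborel h"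
    and test: "\<And>\<phi>::'a \<Rightarrow> real. continuous_on UNIV \<phi> \<Longrightarrow> (\<And>x. \<bar>\<phi> x\<bar> \<le> 1) \<Longrightarrow> (\<integral>y. \<phi> y *\<^sub>R h y \<partial>lborel) = 0"
  shows "AE y in lborel. h y = 0"
proof (rule sigma_finite_measure.density_zero[OF sigma_finite_lborel h])
  have [measurable]: "h \<in> borel_measurable borel" using h by auto
  have hA: "integrable lborel (\<lambda>y. indicator A y *\<^sub>R h y)" if "A \<in> sets borel" for A
    using that h by (intro integrable_mult_indicator) auto
  fix A :: "'a set" assume "A \<in> sets lborel"
  then have A: "A \<in> sigma_sets UNIV (Collect closed)" by (simp add: borel_eq_closed)
  have sb: "sigma_sets UNIV (Collect closed) = sets (borel :: 'a measure)" by (simp add: borel_eq_closed)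
  have st: "Int_stable (Collect closed :: 'a set set)" by (auto simp: Int_stable_def)
  have "Collect closed \<subseteq> Pow (UNIV :: 'a set)" by simp
  from st this A show "set_lebesgue_integral lborel A h = 0"
  proof (induction rule: sigma_sets_induct_disjoint)
    case (basic C)
    show ?case
    proof (cases "C = {}")
      case False
      define \<phi> where "\<phi> \<equiv> \<lambda>k y. exp (- (real k * infdist y C))"
      have "(\<lambda>k. \<integral>y. \<phi> k y *\<^sub>R h y \<partial>lborel) \<longlonglongrightarrow> (\<integral>y. indicator C y *\<^sub>R h y \<partial>lborel)"
      proof (rule integral_dominated_convergence[where w="\<lambda>y. norm (h y)"])
        show "AE y in lborel. (\<lambda>k. \<phi> k y *\<^sub>R h y) \<longlonglongrightarrow> indicator C y *\<^sub>R h y"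
        proof (intro AE_I2 tendsto_scaleR tendsto_const)
          fix y
          show "(\<lambda>k. \<phi> k y) \<longlonglongrightarrow> indicator C y"
          proof (cases "y \<in> C")
            case False
            then have "infdist y C > 0" using basic \<open>C \<noteq> {}\<close> by (intro infdist_pos_not_in_closed) auto
            then have "(\<lambda>k. exp (- (real k * infdist y C))) \<longlonglongrightarrow> 0" by real_asymp
            then show ?thesis using False by (simp add: \<phi>_def)
          qed (simp add: \<phi>_def)
        qed
        show "AE y in lborel. norm (\<phi> k y *\<^sub>R h y) \<le> norm (h y)" for k
          by (intro AE_I2) (auto simp: \<phi>_def infdist_nonneg intro!: mult_left_le_one_le)
        show "(\<lambda>y. \<phi> k y *\<^sub>R h y) \<in> borel_measurable lborel" for k
          unfolding \<phi>_def
          by (intro borel_measurable_scaleR) (auto intro!: borel_measurable_continuous_onI continuous_intros)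
        show "(\<lambda>y. indicator C y *\<^sub>R h y) \<in> borel_measurable lborel" using basic by auto
      qed (use h in auto)
      moreover have "(\<integral>y. \<phi> k y *\<^sub>R h y \<partial>lborel) = 0" for k
        unfolding \<phi>_def by (intro test continuous_intros) (auto simp: infdist_nonneg)
      ultimately show ?thesis by (simp add: LIMSEQ_const_iff set_lebesgue_integral_def)
    qed (simp add: set_lebesgue_integral_def)
  next
    case empty
    show ?case by (simp add: set_lebesgue_integral_def)
  next
    case (compl A)
    then have A: "A \<in> sets borel" by (simp add: sb)
    have "indicator (UNIV - A) y *\<^sub>R h y = h y - indicator A y *\<^sub>R h y" for y by (auto simp: indicator_def)
    then have "set_lebesgue_integral lborel (UNIV - A) h = (\<integral>y. h y \<partial>lborel) - set_lebesgue_integral lborel A h"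
      unfolding set_lebesgue_integral_def by (simp add: Bochner_Integration.integral_diff[OF h hA[OF A]])
    also have "(\<integral>y. h y \<partial>lborel) = 0" using test[of "\<lambda>_. 1"] by simp
    finally show ?case using compl by simp
  next
    case (union A)
    then have "\<And>i. A i \<in> sets borel" by (auto simp: sb)
    then show ?case using union hA[of "\<Union>i. A i"]
      by (subst lebesgue_integral_countable_add) (auto simp: disjoint_family_on_def set_integrable_def)
  qed
qed

section \<open>Unique continuation for Riesz potentials\<close>

text \<open>
  Young's inequality splits the integrand into \<open>\<bar>g\<bar>\<^sup>p\<close> and a power of \<open>\<bar>z - x\<bar>\<close> with exponent \<open>a q\<close>,
  where \<open>q\<close> is conjugate to \<open>p\<close>. The hypothesis \<open>p (a + n) < n\<close> is \<open>a q < - n\<close> in disguise, the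
  condition for integrability at infinity. For \<open>p = 1\<close> it reads \<open>a < 0\<close>, and then the kernel is
  simply bounded away from \<open>x\<close>.
\<close>

lemma integrable_riesz_kernel:
  fixes g :: "'a::euclidean_space \<Rightarrow> complex"
  assumes [measurable]: "g \<in> borel_measurable borel"
    and r: "r > 0" and g0: "\<And>z. z \<in> ball x r \<Longrightarrow> g z = 0"
    and p: "1 \<le> p" "p * (a + real DIM('a)) < real DIM('a)"
    and Lp: "integrable lborel (\<lambda>z. norm (g z) powr p)"
  shows "integrable lborel (\<lambda>z. norm (z - x) powr a *\<^sub>R g z)"
proof (cases "p = 1")
  case True
  have int: "integrable lborel g" using Lp True by (simp add: integrable_norm_iff)
  show ?thesis
  proof (rule Bochner_Integration.integrable_bound)
    show "integrable lborel (\<lambda>z. (r powr a) *\<^sub>R g z)" by (intro integrable_scaleR_right int)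
    show "AE z in lborel. norm (norm (z - x) powr a *\<^sub>R g z) \<le> norm (r powr a *\<^sub>R g z)"
    proof (intro AE_I2)
      fix z
      show "norm (norm (z - x) powr a *\<^sub>R g z) \<le> norm (r powr a *\<^sub>R g z)"
      proof (cases "z \<in> ball x r")
        case False
        then have "norm (z - x) powr a \<le> r powr a"
          using r p True by (intro powr_mono2') (auto simp: dist_norm norm_minus_commute)
        then show ?thesis by (simp add: mult_right_mono)
      qed (simp add: g0)
    qed
  qed measurable
next
  case False
  define q where "q = p / (p - 1)"
  have p1: "p > 1" using p(1) False by simp
  have q: "q > 1" "1 / p + 1 / q = 1" using p1 by (simp_all add: q_def field_simps)
  have "a * p < - real DIM('a) * (p - 1)" using p(2) by (simp add: algebra_simps)
  then have aq: "a * q < - real DIM('a)" using p1 by (simp add: q_def pos_divide_less_eq)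
  from lborel_integral_affine(1)[OF _ integrable_power_off_ball[OF aq r], of 1 "- x"]
  have off: "integrable lborel (\<lambda>z. indicator (- ball 0 r) (z - x) * norm (z - x) powr (a * q))"
    by simp
  show ?thesis
  proof (rule Bochner_Integration.integrable_bound)
    show "integrable lborel (\<lambda>z. norm (g z) powr p / p + indicator (- ball 0 r) (z - x) * norm (z - x) powr (a * q) / q)"
      by (intro Bochner_Integration.integrable_add integrable_divide Lp off)
    show "AE z in lborel. norm (norm (z - x) powr a *\<^sub>R g z)
        \<le> norm (norm (g z) powr p / p + indicator (- ball 0 r) (z - x) * norm (z - x) powr (a * q) / q)"
    proof (intro AE_I2)
      fix z
      show "norm (norm (z - x) powr a *\<^sub>R g z)
        \<le> norm (norm (g z) powr p / p + indicator (- ball 0 r) (z - x) * norm (z - x) powr (a * q) / q)"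
      proof (cases "z \<in> ball x r")
        case False
        have "norm (g z) * norm (z - x) powr a \<le> norm (g z) powr p / p + (norm (z - x) powr a) powr q / q"
          using p1 q by (intro Youngs_inequality) auto
        then show ?thesis using False by (simp add: powr_powr dist_norm norm_minus_commute mult.commute)
      qed (simp add: g0)
    qed
  qed measurable
qed

text \<open>
  Iterating the Laplacian step needs \<open>a - 2 k + n \<noteq> 2\<close> for every \<open>k\<close>; with \<open>a + n = 2 s\<close> this says
  that \<open>s\<close> is not a positive integer. The lemmas on Gaussian averages then take over. Since \<open>g\<close>
  itself need not be integrable, the conclusion is drawn for its product \<open>h\<close> with a Gaussian.
\<close>

theorem riesz_potential_unique_continuation:
  fixes g :: "'a::euclidean_space \<Rightarrow> complex" and a :: real
  assumes [measurable]: "g \<in> borel_measurable borel" and U: "open U" "U \<noteq> {}"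
    and g0: "\<And>z. z \<in> U \<Longrightarrow> g z = 0"
    and a: "a < 0" "\<And>k::nat. a + real DIM('a) \<noteq> 2 + 2 * real k"
    and int: "\<And>x. x \<in> U \<Longrightarrow> integrable lborel (\<lambda>z. norm (z - x) powr a *\<^sub>R g z)"
    and ae: "AE x in lborel. x \<in> U \<longrightarrow> (\<integral>z. norm (z - x) powr a *\<^sub>R g z \<partial>lborel) = 0"
  shows "AE z in lborel. g z = 0"
proof -
  have ball: "\<exists>r>0. \<forall>z\<in>ball x r. g z = 0" if "x \<in> U" for x
    using U(1) that g0 by (meson open_contains_ball subsetD)
  have int_k: "integrable lborel (\<lambda>z. norm (z - x) powr (a - 2 * real k) *\<^sub>R g z)" if x: "x \<in> U" for x k
  proof -
    obtain r where "r > 0" "\<forall>z\<in>ball x r. g z = 0" using ball[OF x] by blast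
    then show ?thesis by (intro integrable_smaller_power[OF assms(1) _ _ int[OF x], where r=r]) auto
  qed
  have zero_k: "(\<integral>z. norm (z - x) powr (a - 2 * real k) *\<^sub>R g z \<partial>lborel) = 0" if "x \<in> U" for x k
    using that
  proof (induction k arbitrary: x)
    case 0
    then show ?case using potential_zero_on_open[OF assms(1) U(1) g0 _ int ae] a(1) by simp
  next
    case (Suc k)
    have "a - 2 * real k + real DIM('a) \<noteq> 2" using a(2)[of k] by linarith
    from potential_zero_laplacian[OF assms(1) U(1) g0 _ this int_k Suc.IH Suc.prems]
    show ?case using a(1) by (simp add: algebra_simps)
  qed
  have gauss: "integrable lborel (\<lambda>z. exp (- c * (norm (z - x))\<^sup>2) *\<^sub>R g z)"
      "(\<integral>z. exp (- c * (norm (z - x))\<^sup>2) *\<^sub>R g z \<partial>lborel) = 0" if x: "x \<in> U" and c: "c > 0" for x c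
  proof -
    obtain r where r: "r > 0" "\<And>z. z \<in> ball x r \<Longrightarrow> g z = 0" using ball[OF x] by blast
    note * = gaussian_average_zero[OF assms(1) r int[OF x] zero_k[OF x] c]
    show "integrable lborel (\<lambda>z. exp (- c * (norm (z - x))\<^sup>2) *\<^sub>R g z)" by (rule *(1))
    show "(\<integral>z. exp (- c * (norm (z - x))\<^sup>2) *\<^sub>R g z \<partial>lborel) = 0" by (rule *(2))
  qed
  obtain x\<^sub>0 where x0: "x\<^sub>0 \<in> U" using U(2) by blast
  obtain r where r: "r > 0" "ball x\<^sub>0 r \<subseteq> U" using U(1) x0 by (auto simp: open_contains_ball)
  have everywhere: "(\<integral>z. exp (- c * (norm (z - x))\<^sup>2) *\<^sub>R g z \<partial>lborel) = 0" if "c > 0" for c x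
  proof (rule gaussian_averages_zero_extend[OF assms(1) r(1) that])
    show "integrable lborel (\<lambda>z. exp (- c' * (norm (z - x\<^sub>0))\<^sup>2) *\<^sub>R g z)" if "c' > 0" for c'
      by (rule gauss(1)[OF x0 that])
    show "(\<integral>z. exp (- c * (norm (z - x'))\<^sup>2) *\<^sub>R g z \<partial>lborel) = 0" if "x' \<in> ball x\<^sub>0 r" for x'
      by (rule gauss(2)[OF subsetD[OF r(2) that] \<open>c > 0\<close>])
  qed
  define h where "h \<equiv> \<lambda>z. exp (- 1 * (norm (z - x\<^sub>0))\<^sup>2) *\<^sub>R g z"
  have h: "integrable lborel h" unfolding h_def by (rule gauss(1)[OF x0]) simp
  have h_zero: "(\<integral>z. exp (- c * (norm (z - x))\<^sup>2) *\<^sub>R h z \<partial>lborel) = 0" if c: "c > 0" for c x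
  proof -
    \<comment> \<open>A product of two Gaussians is a multiple of a Gaussian centred at a weighted mean \<open>y\<close> of the
      two centres (complete the square), so the averages of \<open>h\<close> are averages of \<open>g\<close>.\<close>
    define d where "d = x - x\<^sub>0"
    define y where "y = x\<^sub>0 + (c / (c + 1)) *\<^sub>R d"
    have "exp (- c * (norm (z - x))\<^sup>2) *\<^sub>R h z
       = exp (- c / (c + 1) * (norm d)\<^sup>2) *\<^sub>R (exp (- (c + 1) * (norm (z - y))\<^sup>2) *\<^sub>R g z)" for z
    proof -
      define u where "u = z - x\<^sub>0"
      define t where "t = c / (c + 1)"
      have tc: "t * (c + 1) = c" using c by (simp add: t_def)
      have zx: "z - x = u - d" "z - y = u - t *\<^sub>R d" by (simp_all add: u_def d_def y_def t_def)
      have sq: "(norm (u - t *\<^sub>R d))\<^sup>2 = (norm u)\<^sup>2 - 2 * t * (u \<bullet> d) + t\<^sup>2 * (norm d)\<^sup>2" for t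
        unfolding power2_norm_eq_inner
        by (simp add: inner_diff_left inner_diff_right inner_commute power2_eq_square algebra_simps)
      have "(c + 1) * (norm (u - t *\<^sub>R d))\<^sup>2 + t * (norm d)\<^sup>2
          = (c + 1) * (norm u)\<^sup>2 - 2 * (t * (c + 1)) * (u \<bullet> d) + t * (t * (c + 1) + 1) * (norm d)\<^sup>2"
        unfolding sq by (simp add: power2_eq_square algebra_simps)
      also have "\<dots> = (c + 1) * (norm u)\<^sup>2 - 2 * c * (u \<bullet> d) + c * (norm d)\<^sup>2"
        unfolding tc by (simp only: tc)
      also have "\<dots> = c * (norm (u - d))\<^sup>2 + (norm u)\<^sup>2"
        using sq[of 1] by (simp add: ring_distribs)
      finally have "(c + 1) * (norm (u - t *\<^sub>R d))\<^sup>2 + t * (norm d)\<^sup>2 = c * (norm (u - d))\<^sup>2 + (norm u)\<^sup>2" .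
      then have "- c * (norm (z - x))\<^sup>2 + - 1 * (norm u)\<^sup>2 = - t * (norm d)\<^sup>2 + - (c + 1) * (norm (z - y))\<^sup>2"
        unfolding zx by linarith
      then have "exp (- c * (norm (z - x))\<^sup>2) * exp (- 1 * (norm u)\<^sup>2)
          = exp (- t * (norm d)\<^sup>2) * exp (- (c + 1) * (norm (z - y))\<^sup>2)"
        by (simp only: exp_add[symmetric])
      then show ?thesis unfolding h_def scaleR_scaleR u_def t_def by (simp only: minus_divide_left)
    qed
    then have "(\<integral>z. exp (- c * (norm (z - x))\<^sup>2) *\<^sub>R h z \<partial>lborel)
       = (\<integral>z. exp (- c / (c + 1) * (norm d)\<^sup>2) *\<^sub>R (exp (- (c + 1) * (norm (z - y))\<^sup>2) *\<^sub>R g z) \<partial>lborel)"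
      by (intro Bochner_Integration.integral_cong refl)
    also have "\<dots> = exp (- c / (c + 1) * (norm d)\<^sup>2) *\<^sub>R (\<integral>z. exp (- (c + 1) * (norm (z - y))\<^sup>2) *\<^sub>R g z \<partial>lborel)"
      by (rule integral_scaleR_right)
    also have "\<dots> = 0" using everywhere[of "c + 1" y] c by simp
    finally show ?thesis .
  qed
  have "AE z in lborel. h z = 0"
    by (rule AE_zero_if_orthogonal_to_continuous[OF h], rule gaussian_averages_zero_test[OF h _ _ h_zero])
  then show ?thesis by (simp add: h_def)
qed

lemma AE_lborel_translate:
  fixes x :: "'a::euclidean_space"
  assumes "AE z in lborel. P z"
  shows "AE y in lborel. P (x + y)"
proof -
  obtain N where N: "{z \<in> space lborel. \<not> P z} \<subseteq> N" "N \<in> null_sets lborel"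
    using AE_E[OF assms] by (metis null_setsI)
  have [measurable]: "N \<in> sets borel" using N(2) by auto
  have "AE z in distr lborel borel ((+) x). z \<notin> N"
    unfolding lborel_distr_plus using N(2) by (rule AE_not_in)
  then have "AE y in lborel. x + y \<notin> N" by (simp add: AE_distr_iff)
  then show ?thesis using N(1) by (auto elim!: AE_mp)
qed

lemma borel_representative:
  fixes f :: "'a::euclidean_space \<Rightarrow> complex"
  assumes f: "f \<in> borel_measurable lebesgue"
  obtains g where "g \<in> borel_measurable borel" "AE x in lborel. f x = g x"
proof -
  have "(\<lambda>x. Re (f x)) \<in> borel_measurable lebesgue" "(\<lambda>x. Im (f x)) \<in> borel_measurable lebesgue"
    using f by measurable
  then obtain u v where uv: "u \<in> borel_measurable lborel" "AE x in lborel. Re (f x) = u x"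
      "v \<in> borel_measurable lborel" "AE x in lborel. Im (f x) = v x"
    using completion_ex_borel_measurable_real[of _ lborel] by blast
  show thesis
  proof (rule that)
    show "(\<lambda>x. Complex (u x) (v x)) \<in> borel_measurable borel"
      unfolding Complex_eq using uv by measurable
    show "AE x in lborel. f x = Complex (u x) (v x)"
      using uv(2,4) by eventually_elim (simp add: complex_eq_iff)
  qed
qed

text \<open>
  Translations preserve null sets, so the transform does not depend on the representative, and the
  integral for a Borel representative can be taken with respect to the Borel measure.
\<close>

lemma ray_avg_AE_representative:
  fixes f g :: "real^'n \<Rightarrow> complex"
  assumes f: "f \<in> borel_measurable lebesgue" and g [measurable]: "g \<in> borel_measurable borel"
    and fg: "AE z in lborel. f z = g z"
  shows "ray_avg s f x = frac_const CARD('n) (- s) *\<^sub>R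
           (\<integral>z. norm (z - x) powr (2 * s - real CARD('n)) *\<^sub>R g z \<partial>lborel)"
proof -
  let ?a = "2 * s - real CARD('n)"
  have "(\<lambda>y. x + y) \<in> lebesgue \<rightarrow>\<^sub>M lebesgue"
    using lebesgue_affine_measurable[of "\<lambda>_. 1" x] by (simp add: euclidean_representation)
  then have [measurable]: "(\<lambda>y. f (x + y)) \<in> borel_measurable lebesgue"
    using measurable_compose f by blast
  have [measurable]: "(\<lambda>y. norm y powr ?a) \<in> borel_measurable lebesgue"
    by (intro measurable_completion) measurable
  have gm: "(\<lambda>y. norm y powr ?a *\<^sub>R g (x + y)) \<in> borel_measurable lborel" by measurable
  have "(\<integral>y. norm y powr ?a *\<^sub>R f (x + y) \<partial>lebesgue) = (\<integral>y. norm y powr ?a *\<^sub>R g (x + y) \<partial>lebesgue)"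
  proof (rule integral_cong_AE)
    show "AE y in lebesgue. norm y powr ?a *\<^sub>R f (x + y) = norm y powr ?a *\<^sub>R g (x + y)"
      using AE_completion[OF AE_lborel_translate[OF fg, of x]] by eventually_elim simp
  qed (use gm in \<open>auto intro: measurable_completion\<close>)
  also have "\<dots> = (\<integral>y. norm y powr ?a *\<^sub>R g (x + y) \<partial>lborel)"
    by (rule integral_completion[OF gm])
  also have "\<dots> = (\<integral>z. norm (z - x) powr ?a *\<^sub>R g z \<partial>distr lborel borel ((+) x))"
    by (subst integral_distr) auto
  finally show ?thesis unfolding ray_avg_def lborel_distr_plus by simp
qed

theorem theoremC:
  fixes f :: "real^'n \<Rightarrow> complex" and s :: real and U :: "(real^'n) set"
  assumes "CARD('n) \<ge> 2"
    and "0 < s" and "s \<le> real CARD('n) / 4" and "s \<notin> \<int>"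
    and "in_Lp (2 * real CARD('n) / (real CARD('n) + 4 * s)) f"
    and "open U" and "U \<noteq> {}"
    and "AE x in lebesgue. x \<in> U \<longrightarrow> f x = 0"
    and "AE x in lebesgue. x \<in> U \<longrightarrow> ray_avg s f x = 0"
  shows "AE x in lebesgue. f x = 0"
proof -
  define n where "n = real CARD('n)"
  define p where "p = 2 * n / (n + 4 * s)"
  have n: "n > 0" by (simp add: n_def)
  have s: "0 < s" "4 * s \<le> n" using assms(2,3) by (auto simp: n_def)
  have f: "f \<in> borel_measurable lebesgue" and Lp: "integrable lebesgue (\<lambda>x. norm (f x) powr p)"
    using assms(5) by (auto simp: in_Lp_def p_def n_def)
  obtain g\<^sub>1 where g1: "g\<^sub>1 \<in> borel_measurable borel" "AE x in lborel. f x = g\<^sub>1 x"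
    using borel_representative[OF f] .
  \<comment> \<open>A representative that vanishes everywhere on \<open>U\<close>, not just almost everywhere.\<close>
  define g where "g \<equiv> \<lambda>z. if z \<in> U then 0 else g\<^sub>1 z"
  have [measurable]: "U \<in> sets borel" using assms(6) by simp
  have g [measurable]: "g \<in> borel_measurable borel"
    unfolding g_def using g1(1) by measurable
  have fg: "AE x in lborel. f x = g x"
    using g1(2) assms(8)[unfolded AE_completion_iff] by eventually_elim (auto simp: g_def)
  have g0: "g z = 0" if "z \<in> U" for z using that by (simp add: g_def)
  have Lp_g: "integrable lborel (\<lambda>z. norm (g z) powr p)"
  proof -
    have "integrable lebesgue (\<lambda>z. norm (g z) powr p)"
    proof (rule integrable_cong_AE_imp[OF Lp])
      show "(\<lambda>z. norm (g z) powr p) \<in> borel_measurable lebesgue"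
        by (intro measurable_completion) measurable
      show "AE z in lebesgue. norm (f z) powr p = norm (g z) powr p"
        using AE_completion[OF fg] by eventually_elim simp
    qed
    then show ?thesis by (subst (asm) integrable_completion) auto
  qed
  have p: "1 \<le> p" "p * (2 * s - n + n) < n"
  proof -
    show "1 \<le> p" using s n by (simp add: p_def)
    have "p * (2 * s) = n * (4 * s / (n + 4 * s))" by (simp add: p_def)
    also have "\<dots> < n * 1" using s n by (intro mult_strict_left_mono) auto
    finally show "p * (2 * s - n + n) < n" by simp
  qed
  have const: "frac_const CARD('n) (- s) \<noteq> 0"
  proof -
    have "Gamma ((n + 2 * (- s)) / 2) > 0" "Gamma s > 0" using s n by (auto intro!: Gamma_real_pos)
    then show ?thesis by (simp add: frac_const_def n_def)
  qed
  have "AE z in lborel. g z = 0"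
  proof (rule riesz_potential_unique_continuation[OF g assms(6,7) g0])
    show "2 * s - n < 0" using s n by simp
    show "2 * s - n + real DIM(real^'n) \<noteq> 2 + 2 * real k" for k
    proof
      assume "2 * s - n + real DIM(real^'n) = 2 + 2 * real k"
      then have "s = real (Suc k)" by (simp add: n_def)
      then show False using assms(4) by simp
    qed
    show "integrable lborel (\<lambda>z. norm (z - x) powr (2 * s - n) *\<^sub>R g z)" if x: "x \<in> U" for x
    proof -
      obtain r where "r > 0" "ball x r \<subseteq> U" using assms(6) x by (auto simp: open_contains_ball)
      then show ?thesis using p g0 Lp_g
        by (intro integrable_riesz_kernel[OF g, of r x p]) (auto simp: n_def)
    qed
    show "AE x in lborel. x \<in> U \<longrightarrow> (\<integral>z. norm (z - x) powr (2 * s - n) *\<^sub>R g z \<partial>lborel) = 0"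
      using assms(9)[unfolded AE_completion_iff]
      by eventually_elim (simp add: ray_avg_AE_representative[OF f g fg] n_def const)
  qed
  then have "AE x in lborel. f x = 0" using fg by eventually_elim simp
  then show ?thesis by (rule AE_completion)
qed

end
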